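(* Let $D$ be a generalized smooth integrable distribution defined on the second countable finite dimensional manifold $P$. Suppose that there exist continuous first integrals $C_i\in C^0(P)$, $i\in I$, of the foliation induced by $D$ that separate its regular leaves. Additionally, assume that the map $C:P\to\mathbb{R}^I$ defined by $C(z):=(C_i(z))_{i\in I}$, $z\in P$, is open onto its image when $\mathbb{R}^I$ is endowed with the product topology. Then for any $z\in P$ $$\overline{T}_2(z)=\bigcap_{i\in I}C_i^{-1}(C_i(z)).$$
   Context: A smooth generalized distribution $D$ on a smooth manifold $P$ assigns to each point a subspace of the tangent space (of possibly varying dimension) locally spanned by values of smooth local sections; it is integrable if $P$ is partitioned into maximal connected immersed integral submanifolds, called leaves (they form a generalized foliation). A point $z\in P$ is regular if it has an open neighborhood such that all the leaves intersecting it have the same dimension; a leaf is regular if it consists of regular points. A continuous first integral is a continuous real function constant on the leaves. The functions $C_i$ separate the regular leaves if for any two distinct regular leaves there is $i\in I$ such that $C_i$ takes different values on them. The leaf space $P/D$ carries the quotient topology and $\pi_D:P\to P/D$ is the projection. For a topological space $X$ and $x\in X$, $T_2(x):=\{y\in X\mid U_x\cap U_y\neq\emptyset$ for any two open neighborhoods $U_x,U_y$ of $x$ and $y\}$. For $x\in P$, $\overline{T}_2(x):=\pi_D^{-1}(T_2(\pi_D(x)))$. *)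

theory Defs
  imports "HOL-Analysis.Analysis" "HOL-Library.Function_Algebras" "HOL-Library.Disjoint_Sets"
begin

section \<open>Smooth maps between subsets of Euclidean spaces\<close>

text \<open>\<open>Ck_on\<close> is meant for open sets of a finite-dimensional domain, where
  \<open>frechet_derivative f (at x)\<close> depends continuously on \<open>x\<close> iff each of its values does.\<close>

primrec Ck_on :: "nat \<Rightarrow> ('a::real_normed_vector \<Rightarrow> 'b::real_normed_vector) \<Rightarrow> 'a set \<Rightarrow> bool" where
  "Ck_on 0 f W \<longleftrightarrow> continuous_on W f"
| "Ck_on (Suc k) f W \<longleftrightarrow> (\<forall>x\<in>W. f differentiable (at x)) \<and>
     (\<forall>v. Ck_on k (\<lambda>x. frechet_derivative f (at x) v) W)"

text \<open>Smoothness on an arbitrary set means local smooth extendability to open sets of the ambient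
  space.  On a set that is open in a linear subspace \<open>E\<close> this is the usual smoothness of a map
  defined on an open subset of \<open>E\<close> (extend by the orthogonal projection onto \<open>E\<close>).\<close>

definition smooth_on :: "'a::real_normed_vector set \<Rightarrow> ('a \<Rightarrow> 'b::real_normed_vector) \<Rightarrow> bool" where
  "smooth_on S f \<longleftrightarrow>
     (\<forall>x\<in>S. \<exists>W g. open W \<and> x \<in> W \<and> (\<forall>k. Ck_on k g W) \<and> (\<forall>y\<in>S \<inter> W. g y = f y))"

definition dir_deriv :: "('a::real_normed_vector \<Rightarrow> 'b::real_normed_vector) \<Rightarrow> 'a \<Rightarrow> 'a \<Rightarrow> 'b" where
  "dir_deriv f p v = vector_derivative (\<lambda>t. f (p + t *\<^sub>R v)) (at 0)"

section \<open>Smooth manifolds\<close>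

text \<open>A manifold of dimension \<open>n\<close> is modelled on an \<open>n\<close>-dimensional linear subspace of a Euclidean
  space \<open>'e\<close>.  This includes dimension 0 (euclidean space types have positive dimension), and it lets
  submanifolds of all dimensions be described with the same types.  A chart is a domain together
  with a coordinate map; the values of the map outside the domain are irrelevant.\<close>

type_synonym ('a, 'e) chart = "'a set \<times> ('a \<Rightarrow> 'e)"

record ('a, 'e) manifold =
  mtop :: "'a topology"
  model :: "'e set"
  atlas :: "('a, 'e) chart set"

definition chart_inv :: "('a, 'e) chart \<Rightarrow> 'e \<Rightarrow> 'a" where
  "chart_inv c = inv_into (fst c) (snd c)"

definition smooth_manifold :: "('a, 'e::euclidean_space) manifold \<Rightarrow> bool" where
  "smooth_manifold M \<longleftrightarrow>
     subspace (model M) \<and>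
     Hausdorff_space (mtop M) \<and>
     (\<forall>c\<in>atlas M.
        openin (mtop M) (fst c) \<and>
        openin (top_of_set (model M)) (snd c ` fst c) \<and>
        homeomorphic_map (subtopology (mtop M) (fst c)) (top_of_set (snd c ` fst c)) (snd c)) \<and>
     (\<Union>c\<in>atlas M. fst c) = topspace (mtop M) \<and>
     (\<forall>c\<in>atlas M. \<forall>d\<in>atlas M. smooth_on (snd c ` (fst c \<inter> fst d)) (snd d \<circ> chart_inv c))"

definition mdim :: "('a, 'e::euclidean_space) manifold \<Rightarrow> nat" where
  "mdim M = dim (model M)"

definition charts_at :: "('a, 'e) manifold \<Rightarrow> 'a \<Rightarrow> ('a, 'e) chart set" where
  "charts_at M x = {c \<in> atlas M. x \<in> fst c}"

section \<open>Tangent vectors\<close>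

text \<open>Functions with values in a real vector space form a real vector space (pointwise operations).
  This makes \<^const>\<open>subspace\<close> and \<^const>\<open>span\<close> available for tangent vectors.\<close>

instantiation "fun" :: (type, real_vector) real_vector
begin

definition scaleR_fun :: "real \<Rightarrow> ('a \<Rightarrow> 'b) \<Rightarrow> 'a \<Rightarrow> 'b" where
  "scaleR_fun r f = (\<lambda>x. r *\<^sub>R f x)"

instance
  by standard (simp_all add: scaleR_fun_def plus_fun_def fun_eq_iff scaleR_add_right scaleR_add_left)

end

text \<open>A tangent vector at \<open>x\<close> is the family of its coordinate representatives, one for each chart
  around \<open>x\<close>, related by the derivatives of the chart transitions.  The value at charts that
  do not contain \<open>x\<close> is fixed to 0, so that equality of tangent vectors is equality of functions.\<close>

type_synonym ('a, 'e) tangent = "('a, 'e) chart \<Rightarrow> 'e"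

definition tangent_space ::
  "('a, 'e::euclidean_space) manifold \<Rightarrow> 'a \<Rightarrow> ('a, 'e) tangent set" where
  "tangent_space M x =
     {v. (\<forall>c\<in>charts_at M x. v c \<in> model M) \<and>
         (\<forall>c\<in>charts_at M x. \<forall>d\<in>charts_at M x.
            v d = dir_deriv (snd d \<circ> chart_inv c) (snd c x) (v c)) \<and>
         (\<forall>c. c \<notin> charts_at M x \<longrightarrow> v c = 0)}"

text \<open>By the chain rule the choice of the chart \<open>c\<close> is immaterial.\<close>

definition tangent_map ::
  "('a, 'e::euclidean_space) manifold \<Rightarrow> ('b, 'f::euclidean_space) manifold \<Rightarrow> ('a \<Rightarrow> 'b) \<Rightarrow> 'a
     \<Rightarrow> ('a, 'e) tangent \<Rightarrow> ('b, 'f) tangent" where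
  "tangent_map M N f x v =
     (let c = (SOME c. c \<in> charts_at M x)
      in (\<lambda>d. if d \<in> charts_at N (f x)
              then dir_deriv (snd d \<circ> f \<circ> chart_inv c) (snd c x) (v c)
              else 0))"

definition smooth_map ::
  "('a, 'e::euclidean_space) manifold \<Rightarrow> ('b, 'f::euclidean_space) manifold \<Rightarrow> ('a \<Rightarrow> 'b) \<Rightarrow> bool" where
  "smooth_map M N f \<longleftrightarrow>
     continuous_map (mtop M) (mtop N) f \<and>
     (\<forall>c\<in>atlas M. \<forall>d\<in>atlas N.
        smooth_on (snd c ` (fst c \<inter> f -` fst d)) (snd d \<circ> f \<circ> chart_inv c))"

definition immersion ::
  "('a, 'e::euclidean_space) manifold \<Rightarrow> ('b, 'f::euclidean_space) manifold \<Rightarrow> ('a \<Rightarrow> 'b) \<Rightarrow> bool" where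
  "immersion M N f \<longleftrightarrow>
     smooth_map M N f \<and> (\<forall>x\<in>topspace (mtop M). inj_on (tangent_map M N f x) (tangent_space M x))"

text \<open>An immersed submanifold carries its own topology, in general finer than the subspace topology.\<close>

definition immersed_submanifold ::
  "('a, 'e::euclidean_space) manifold \<Rightarrow> ('a, 'e) manifold \<Rightarrow> bool" where
  "immersed_submanifold N P \<longleftrightarrow>
     smooth_manifold N \<and> topspace (mtop N) \<subseteq> topspace (mtop P) \<and> immersion N P (\<lambda>x. x)"

section \<open>Generalized distributions and their leaves\<close>

definition smooth_vector_field_on ::
  "('a, 'e::euclidean_space) manifold \<Rightarrow> 'a set \<Rightarrow> ('a \<Rightarrow> ('a, 'e) tangent) \<Rightarrow> bool" where
  "smooth_vector_field_on P U X \<longleftrightarrow>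
     openin (mtop P) U \<and>
     (\<forall>y\<in>U. X y \<in> tangent_space P y) \<and>
     (\<forall>c\<in>atlas P. smooth_on (snd c ` (fst c \<inter> U)) (\<lambda>p. X (chart_inv c p) c))"

definition smooth_local_section ::
  "('a, 'e::euclidean_space) manifold \<Rightarrow> ('a \<Rightarrow> ('a, 'e) tangent set) \<Rightarrow> 'a set
     \<Rightarrow> ('a \<Rightarrow> ('a, 'e) tangent) \<Rightarrow> bool" where
  "smooth_local_section P D U X \<longleftrightarrow> smooth_vector_field_on P U X \<and> (\<forall>y\<in>U. X y \<in> D y)"

definition smooth_distribution ::
  "('a, 'e::euclidean_space) manifold \<Rightarrow> ('a \<Rightarrow> ('a, 'e) tangent set) \<Rightarrow> bool" where
  "smooth_distribution P D \<longleftrightarrow>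
     (\<forall>x\<in>topspace (mtop P).
        subspace (D x) \<and> D x \<subseteq> tangent_space P x \<and>
        D x = span {X x |U X. x \<in> U \<and> smooth_local_section P D U X})"

definition connected_integral_manifold ::
  "('a, 'e::euclidean_space) manifold \<Rightarrow> ('a \<Rightarrow> ('a, 'e) tangent set) \<Rightarrow> ('a, 'e) manifold \<Rightarrow> bool" where
  "connected_integral_manifold P D N \<longleftrightarrow>
     immersed_submanifold N P \<and> topspace (mtop N) \<noteq> {} \<and> connected_space (mtop N) \<and>
     (\<forall>x\<in>topspace (mtop N). tangent_map N P (\<lambda>x. x) x ` tangent_space N x = D x)"

text \<open>The maximal connected integral manifolds, as sets of points.\<close>

definition leaves ::
  "('a, 'e::euclidean_space) manifold \<Rightarrow> ('a \<Rightarrow> ('a, 'e) tangent set) \<Rightarrow> 'a set set" where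
  "leaves P D =
     {topspace (mtop N) |N. connected_integral_manifold P D N \<and>
        (\<forall>N'. connected_integral_manifold P D N' \<and> topspace (mtop N) \<subseteq> topspace (mtop N')
           \<longrightarrow> topspace (mtop N') = topspace (mtop N))}"

definition integrable_distribution ::
  "('a, 'e::euclidean_space) manifold \<Rightarrow> ('a \<Rightarrow> ('a, 'e) tangent set) \<Rightarrow> bool" where
  "integrable_distribution P D \<longleftrightarrow> partition_on (topspace (mtop P)) (leaves P D)"

text \<open>The dimension of a leaf as a manifold; it does not depend on \<open>N\<close>, because the tangent
  spaces of \<open>N\<close> are isomorphic to the values of \<open>D\<close>.\<close>

definition leaf_dim ::
  "('a, 'e::euclidean_space) manifold \<Rightarrow> ('a \<Rightarrow> ('a, 'e) tangent set) \<Rightarrow> 'a set \<Rightarrow> nat" where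
  "leaf_dim P D L =
     (THE k. \<exists>N. connected_integral_manifold P D N \<and> topspace (mtop N) = L \<and> mdim N = k)"

definition regular_point ::
  "('a, 'e::euclidean_space) manifold \<Rightarrow> ('a \<Rightarrow> ('a, 'e) tangent set) \<Rightarrow> 'a \<Rightarrow> bool" where
  "regular_point P D z \<longleftrightarrow>
     (\<exists>U k. openin (mtop P) U \<and> z \<in> U \<and> (\<forall>L\<in>leaves P D. L \<inter> U \<noteq> {} \<longrightarrow> leaf_dim P D L = k))"

definition regular_leaves ::
  "('a, 'e::euclidean_space) manifold \<Rightarrow> ('a \<Rightarrow> ('a, 'e) tangent set) \<Rightarrow> 'a set set" where
  "regular_leaves P D = {L \<in> leaves P D. \<forall>z\<in>L. regular_point P D z}"

definition continuous_first_integral ::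
  "('a, 'e::euclidean_space) manifold \<Rightarrow> ('a \<Rightarrow> ('a, 'e) tangent set) \<Rightarrow> ('a \<Rightarrow> real) \<Rightarrow> bool" where
  "continuous_first_integral P D f \<longleftrightarrow>
     continuous_map (mtop P) euclideanreal f \<and> (\<forall>L\<in>leaves P D. \<forall>x\<in>L. \<forall>y\<in>L. f x = f y)"

definition separates_regular_leaves ::
  "('a, 'e::euclidean_space) manifold \<Rightarrow> ('a \<Rightarrow> ('a, 'e) tangent set) \<Rightarrow> 'i set
     \<Rightarrow> ('i \<Rightarrow> 'a \<Rightarrow> real) \<Rightarrow> bool" where
  "separates_regular_leaves P D I C \<longleftrightarrow>
     (\<forall>L\<in>regular_leaves P D. \<forall>L'\<in>regular_leaves P D. L \<noteq> L' \<longrightarrow>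
        (\<exists>i\<in>I. \<forall>x\<in>L. \<forall>y\<in>L'. C i x \<noteq> C i y))"

section \<open>The leaf space\<close>

definition quotient_topology :: "'a topology \<Rightarrow> ('a \<Rightarrow> 'b) \<Rightarrow> 'b topology" where
  "quotient_topology X f =
     topology (\<lambda>V. V \<subseteq> f ` topspace X \<and> openin X {x \<in> topspace X. f x \<in> V})"

lemma openin_quotient_topology:
  "openin (quotient_topology X f) V \<longleftrightarrow>
     V \<subseteq> f ` topspace X \<and> openin X {x \<in> topspace X. f x \<in> V}"
proof -
  have "istopology (\<lambda>V. V \<subseteq> f ` topspace X \<and> openin X {x \<in> topspace X. f x \<in> V})"
    unfolding istopology_def
  proof (intro conjI allI impI)
    fix S T
    assume S: "S \<subseteq> f ` topspace X \<and> openin X {x \<in> topspace X. f x \<in> S}"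
      and T: "T \<subseteq> f ` topspace X \<and> openin X {x \<in> topspace X. f x \<in> T}"
    show "S \<inter> T \<subseteq> f ` topspace X" using S by blast
    have "{x \<in> topspace X. f x \<in> S \<inter> T}
        = {x \<in> topspace X. f x \<in> S} \<inter> {x \<in> topspace X. f x \<in> T}" by blast
    then show "openin X {x \<in> topspace X. f x \<in> S \<inter> T}" using S T by (simp add: openin_Int)
  next
    fix \<K>
    assume K: "\<forall>K\<in>\<K>. K \<subseteq> f ` topspace X \<and> openin X {x \<in> topspace X. f x \<in> K}"
    show "\<Union>\<K> \<subseteq> f ` topspace X" using K by blast
    have "{x \<in> topspace X. f x \<in> \<Union>\<K>} = (\<Union>K\<in>\<K>. {x \<in> topspace X. f x \<in> K})" by blast
    then show "openin X {x \<in> topspace X. f x \<in> \<Union>\<K>}" using K by auto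
  qed
  then show ?thesis
    by (simp add: quotient_topology_def topology_inverse')
qed

lemma topspace_quotient_topology: "topspace (quotient_topology X f) = f ` topspace X"
proof
  show "topspace (quotient_topology X f) \<subseteq> f ` topspace X"
    by (metis openin_quotient_topology openin_topspace)
  have "{x \<in> topspace X. f x \<in> f ` topspace X} = topspace X" by blast
  then have "openin (quotient_topology X f) (f ` topspace X)"
    by (simp add: openin_quotient_topology)
  then show "f ` topspace X \<subseteq> topspace (quotient_topology X f)"
    by (rule openin_subset)
qed

lemma quotient_map_quotient_topology: "quotient_map X (quotient_topology X f) f"
  by (auto simp: quotient_map_def openin_quotient_topology topspace_quotient_topology)

definition leaf_proj ::
  "('a, 'e::euclidean_space) manifold \<Rightarrow> ('a \<Rightarrow> ('a, 'e) tangent set) \<Rightarrow> 'a \<Rightarrow> 'a set" where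
  "leaf_proj P D x = (THE L. L \<in> leaves P D \<and> x \<in> L)"

definition leaf_space ::
  "('a, 'e::euclidean_space) manifold \<Rightarrow> ('a \<Rightarrow> ('a, 'e) tangent set) \<Rightarrow> 'a set topology" where
  "leaf_space P D = quotient_topology (mtop P) (leaf_proj P D)"

definition T2_set :: "'a topology \<Rightarrow> 'a \<Rightarrow> 'a set" where
  "T2_set X x =
     {y \<in> topspace X. \<forall>U V. openin X U \<and> openin X V \<and> x \<in> U \<and> y \<in> V \<longrightarrow> U \<inter> V \<noteq> {}}"

definition T2_bar ::
  "('a, 'e::euclidean_space) manifold \<Rightarrow> ('a \<Rightarrow> ('a, 'e) tangent set) \<Rightarrow> 'a \<Rightarrow> 'a set" where
  "T2_bar P D z =
     {x \<in> topspace (mtop P). leaf_proj P D x \<in> T2_set (leaf_space P D) (leaf_proj P D z)}"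

end

theory Submission
  imports Defs
begin

text \<open>If \<open>z\<close> and \<open>x\<close> have the same values under \<open>C\<close>, saturated open neighbourhoods \<open>U\<close> and \<open>V\<close> of them
  have overlapping images.  Since \<open>C\<close> is open and continuous and the regular points form a dense open
  set, some regular points of \<open>U\<close> and \<open>V\<close> have the same image.  They lie on regular leaves, which \<open>C\<close>
  separates, so they share a leaf and \<open>U\<close> meets \<open>V\<close>.  Density of the regular points is lower
  semicontinuity of the rank of \<open>D\<close>.  The delicate point is that the leaf of a regular point consists of
  regular points: flows of Lipschitz sections of \<open>D\<close> stay inside leaves and depend continuously on the
  starting point, so they transport regularity along a leaf.\<close>

section \<open>Lipschitz differential equations and maps of class C1\<close>

text \<open>The rank of \<open>D\<close> may jump, so near an irregular point there is no frame of
  \<open>D\<close> and no foliated chart; moreover leaves carry their own finer topology, so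
  tangency of a curve to \<open>D\<close> does not by itself place it in a leaf. One device meets
  both difficulties: a linear map \<open>B\<close> that identifies \<open>D\<close> at a base point
  p with the model of the leaf of p. Vectors \<open>e\<close> of this model lift under
  \<open>B\<close> to sections Y(., e) of \<open>D\<close> on a neighbourhood of p in
  \<open>P\<close>, whatever the rank there. At leaf points near p the lift is unique, so straight
  lines in the parameter space become integral curves, and a flow of unit time leads from p to any
  nearby leaf point. The lifts come from inverting operators that depend on the point in a Lipschitz
  way, which is enough for existence, uniqueness and Gronwall. The direction of transport matters:
  regularity is pulled back from a nearby leaf point to the base point, which makes the irregular
  points open in a leaf.\<close>

lemma gronwall_norm:
  fixes \<delta> :: "real \<Rightarrow> 'a::real_inner"
  assumes deriv: "\<And>t. t \<in> {a..b} \<Longrightarrow> (\<delta> has_vector_derivative \<delta>' t) (at t within {a..b})"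
    and bound: "\<And>t. t \<in> {a..b} \<Longrightarrow> norm (\<delta>' t) \<le> K * norm (\<delta> t)"
    and "a \<le> b"
  shows "norm (\<delta> b) \<le> exp (K * (b - a)) * norm (\<delta> a)"
proof -
  \<comment> \<open>The squared norm stays differentiable at zeros of \<open>\<delta>\<close>. By
    Cauchy-Schwarz its growth rate is at most \<open>2 * K\<close>, which the exponential weight
    cancels.\<close>
  define h where "h t = (\<delta> t \<bullet> \<delta> t) * exp (- 2 * K * t)" for t
  define h' where "h' t = (2 * (\<delta> t \<bullet> \<delta>' t) - 2 * K * (\<delta> t \<bullet> \<delta> t)) * exp (- 2 * K * t)" for t
  have hd: "(h has_real_derivative h' t) (at t within {a..b})" if "t \<in> {a..b}" for t
  proof -
    have "((\<lambda>t. \<delta> t \<bullet> \<delta> t) has_derivative (\<lambda>s. \<delta> t \<bullet> (s *\<^sub>R \<delta>' t) + (s *\<^sub>R \<delta>' t) \<bullet> \<delta> t)) (at t within {a..b})"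
      using deriv[OF that] unfolding has_vector_derivative_def
      by (intro derivative_intros)
    then have "((\<lambda>t. \<delta> t \<bullet> \<delta> t) has_real_derivative 2 * (\<delta> t \<bullet> \<delta>' t)) (at t within {a..b})"
      unfolding has_field_derivative_def
      by (rule has_derivative_eq_rhs) (auto simp: inner_commute algebra_simps)
    moreover have "((\<lambda>t. exp (- 2 * K * t)) has_real_derivative exp (- 2 * K * t) * (- 2 * K)) (at t within {a..b})"
      by (auto intro!: derivative_eq_intros)
    ultimately show ?thesis unfolding h_def[abs_def] h'_def
      by (auto intro!: derivative_eq_intros simp: algebra_simps)
  qed
  have "h b \<le> h a"
  proof (cases "a = b")
    case False
    show ?thesis
    proof (rule DERIV_nonpos_imp_decreasing_open[OF \<open>a \<le> b\<close>])
      fix t assume t: "a < t" "t < b"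
      then have "(h has_real_derivative h' t) (at t)"
        using hd[of t] by (simp add: at_within_Icc_at)
      moreover have "h' t \<le> 0"
      proof -
        have "\<delta> t \<bullet> \<delta>' t \<le> norm (\<delta> t) * norm (\<delta>' t)" by (rule norm_cauchy_schwarz)
        also have "\<dots> \<le> norm (\<delta> t) * (K * norm (\<delta> t))"
          using bound[of t] t by (intro mult_left_mono) auto
        also have "\<dots> = K * (\<delta> t \<bullet> \<delta> t)" by (simp add: dot_square_norm power2_eq_square)
        finally show ?thesis unfolding h'_def by (intro mult_nonpos_nonneg) auto
      qed
      ultimately show "\<exists>y. (h has_real_derivative y) (at t) \<and> y \<le> 0" by blast
    next
      show "continuous_on {a..b} h"
        using hd by (meson DERIV_continuous continuous_on_eq_continuous_within)
    qed
  qed simp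
  then have "(norm (\<delta> b))\<^sup>2 * exp (- 2 * K * b) \<le> (norm (\<delta> a))\<^sup>2 * exp (- 2 * K * a)"
    by (simp add: h_def dot_square_norm)
  then have "(norm (\<delta> b))\<^sup>2 * exp (- 2 * K * b) * exp (2 * K * b)
      \<le> (norm (\<delta> a))\<^sup>2 * exp (- 2 * K * a) * exp (2 * K * b)"
    by (intro mult_right_mono) auto
  moreover have "(norm (\<delta> b))\<^sup>2 * exp (- 2 * K * b) * exp (2 * K * b) = (norm (\<delta> b))\<^sup>2"
    by (simp add: mult.assoc flip: exp_add)
  moreover have "(norm (\<delta> a))\<^sup>2 * exp (- 2 * K * a) * exp (2 * K * b) = (exp (K * (b - a)) * norm (\<delta> a))\<^sup>2"
    by (simp add: mult.assoc power_mult_distrib algebra_simps flip: exp_add exp_double)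
  ultimately have "(norm (\<delta> b))\<^sup>2 \<le> (exp (K * (b - a)) * norm (\<delta> a))\<^sup>2" by (simp only:)
  then show ?thesis by (rule power2_le_imp_le) simp
qed

text \<open>Gronwall applies forwards, and backwards after reversing time. The quantities fed into
  it measure the departure of a curve from a leaf or from a linear subspace.\<close>

lemma vanishing_of_linear_growth:
  fixes \<delta> :: "real \<Rightarrow> 'a::real_inner"
  assumes deriv: "\<And>t. t \<in> {a..b} \<Longrightarrow> (\<delta> has_vector_derivative \<delta>' t) (at t within {a..b})"
    and bound: "\<And>t. t \<in> {a..b} \<Longrightarrow> norm (\<delta>' t) \<le> K * norm (\<delta> t)"
    and t0: "t0 \<in> {a..b}" and zero: "\<delta> t0 = 0" and t: "t \<in> {a..b}"
  shows "\<delta> t = 0"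
proof (cases "t0 \<le> t")
  case True
  have "norm (\<delta> t) \<le> exp (K * (t - t0)) * norm (\<delta> t0)"
  proof (rule gronwall_norm[of t0 t \<delta> \<delta>'])
    fix s assume "s \<in> {t0..t}"
    then show "(\<delta> has_vector_derivative \<delta>' s) (at s within {t0..t})"
      using t0 t by (intro has_vector_derivative_within_subset[OF deriv]) auto
  qed (use t0 t bound True in auto)
  then show ?thesis using zero by simp
next
  case False
  have "norm (\<delta> (- (- t))) \<le> exp (K * (- t - - t0)) * norm (\<delta> (- (- t0)))"
  proof (rule gronwall_norm[of "- t0" "- t" "\<lambda>s. \<delta> (- s)" "\<lambda>s. - \<delta>' (- s)"])
    fix s assume s: "s \<in> {- t0..- t}"
    have "(\<delta> has_vector_derivative \<delta>' (- s)) (at (- s) within uminus ` {- t0..- t})"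
      using s t0 t by (intro has_vector_derivative_within_subset[OF deriv]) auto
    moreover have "(uminus has_vector_derivative - 1) (at s within {- t0..- t})"
      by (auto intro!: derivative_eq_intros)
    ultimately show "((\<lambda>s. \<delta> (- s)) has_vector_derivative - \<delta>' (- s)) (at s within {- t0..- t})"
      using vector_diff_chain_within[of uminus "- 1" s "{- t0..- t}" \<delta> "\<delta>' (- s)"]
      by (simp add: o_def)
  qed (use t0 t bound False in auto)
  then show ?thesis using zero by simp
qed

text \<open>The Lipschitz constant 1/2 makes the integral operator a contraction over the whole unit
  interval, so no short existence time appears. Later the bound is met by taking the lifted vector
  \<open>e\<close> small.\<close>

lemma picard_unit_interval:
  fixes F :: "'a::euclidean_space \<Rightarrow> 'a"
  assumes lip: "\<And>x y. norm (F x - F y) \<le> norm (x - y) / 2"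
  obtains \<gamma> where "\<gamma> 0 = x0"
    "\<And>t. t \<in> {0..1} \<Longrightarrow> (\<gamma> has_vector_derivative F (\<gamma> t)) (at t within {0..1})"
proof -
  \<comment> \<open>Clamping time to the unit interval turns functions on it into bounded continuous
    functions on the line, a complete space for the fixed point theorem.\<close>
  define cl :: "real \<Rightarrow> real" where "cl t = max 0 (min 1 t)" for t
  have cl: "cl t \<in> {0..1}" for t by (auto simp: cl_def)
  have contcl: "continuous_on UNIV cl" unfolding cl_def by (intro continuous_intros)
  have contF: "continuous_on UNIV F"
  proof (rule continuous_on_iff[THEN iffD2], intro ballI allI impI)
    fix x :: 'a and e :: real assume "e > 0"
    then show "\<exists>d>0. \<forall>x'\<in>UNIV. dist x' x < d \<longrightarrow> dist (F x') (F x) < e"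
      using lip by (intro exI[of _ e]) (auto simp: dist_norm intro: le_less_trans[OF lip])
  qed
  define J where "J x t = x0 + integral {0..cl t} (\<lambda>s. F (apply_bcontfun x s))"
    for x :: "real \<Rightarrow>\<^sub>C 'a" and t
  have contx: "continuous_on S (\<lambda>s. F (apply_bcontfun x s))" for x :: "real \<Rightarrow>\<^sub>C 'a" and S
    by (rule continuous_on_compose2[OF contF]) (auto intro!: continuous_intros)
  have intx: "(\<lambda>s. F (apply_bcontfun x s)) integrable_on {0..t}" for x :: "real \<Rightarrow>\<^sub>C 'a" and t
    by (rule integrable_continuous_real[OF contx])
  have J: "J x \<in> bcontfun" for x
  proof -
    have ci: "continuous_on {0..1} (\<lambda>t. x0 + integral {0..t} (\<lambda>s. F (apply_bcontfun x s)))"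
      by (intro continuous_intros indefinite_integral_continuous_1 intx)
    have "continuous_on UNIV (J x)" unfolding J_def
      by (rule continuous_on_compose2[OF ci contcl]) (use cl in auto)
    moreover have "range (J x) \<subseteq> (\<lambda>t. x0 + integral {0..t} (\<lambda>s. F (apply_bcontfun x s))) ` {0..1}"
      using cl by (force simp: J_def)
    then have "bounded (range (J x))"
      using compact_continuous_image[OF ci] compact_imp_bounded bounded_subset by blast
    ultimately show ?thesis by (simp add: bcontfun_def)
  qed
  have "dist (Bcontfun (J x)) (Bcontfun (J y)) \<le> 1 / 2 * dist x y" for x y
  proof (rule dist_bound)
    fix t
    have "dist (J x t) (J y t) = norm (integral {0..cl t} (\<lambda>s. F (apply_bcontfun x s) - F (apply_bcontfun y s)))"
      using intx by (simp add: J_def dist_norm integral_diff)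
    also have "\<dots> \<le> (1 / 2 * dist x y) * (cl t - 0)"
    proof (rule integral_bound)
      fix s
      have "norm (F (apply_bcontfun x s) - F (apply_bcontfun y s)) \<le> dist (apply_bcontfun x s) (apply_bcontfun y s) / 2"
        using lip by (simp add: dist_norm)
      also have "\<dots> \<le> 1 / 2 * dist x y" using dist_bounded[of x s y] by simp
      finally show "norm (F (apply_bcontfun x s) - F (apply_bcontfun y s)) \<le> 1 / 2 * dist x y" .
    qed (use cl in \<open>auto intro!: continuous_intros contx\<close>)
    also have "\<dots> \<le> (1 / 2 * dist x y) * 1" using cl[of t] by (intro mult_left_mono) auto
    finally show "dist (apply_bcontfun (Bcontfun (J x)) t) (apply_bcontfun (Bcontfun (J y)) t) \<le> 1 / 2 * dist x y"
      using J by (simp add: Bcontfun_inverse)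
  qed
  then have "\<exists>!x. Bcontfun (J x) = x"
    by (intro banach_fix_type[of "1/2"]) auto
  then obtain x where x: "Bcontfun (J x) = x" by blast
  then have xJ: "apply_bcontfun x t = J x t" for t
    using J Bcontfun_inverse by metis
  show thesis
  proof (rule that[of "apply_bcontfun x"])
    show "apply_bcontfun x 0 = x0" using xJ[of 0] by (simp add: J_def cl_def)
  next
    fix t :: real assume t: "t \<in> {0..1}"
    have "((\<lambda>u. integral {0..u} (\<lambda>s. F (apply_bcontfun x s))) has_vector_derivative F (apply_bcontfun x t)) (at t within {0..1})"
      by (rule integral_has_vector_derivative[OF contx t])
    then have "((\<lambda>u. x0 + integral {0..u} (\<lambda>s. F (apply_bcontfun x s))) has_vector_derivative F (apply_bcontfun x t)) (at t within {0..1})"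
      by (auto intro!: derivative_eq_intros)
    then show "(apply_bcontfun x has_vector_derivative F (apply_bcontfun x t)) (at t within {0..1})"
    proof (rule has_vector_derivative_transform[OF t, rotated])
      fix u :: real assume "u \<in> {0..1}"
      then show "apply_bcontfun x u = x0 + integral {0..u} (\<lambda>s. F (apply_bcontfun x s))"
        using xJ[of u] by (simp add: J_def cl_def)
    qed
  qed
qed

text \<open>The hypothesis gives \<open>norm u \<le> 2 * norm (L u)\<close>; this yields
  injectivity, and finite dimension yields surjectivity.\<close>

lemma perturbed_identity:
  fixes L :: "'a::euclidean_space \<Rightarrow> 'a"
  assumes "linear L" and near: "\<And>u. norm (L u - u) \<le> norm u / 2"
  shows "bij L" "norm (inv L u) \<le> 2 * norm u"
proof -
  have low: "norm u \<le> 2 * norm (L u)" for u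
    using near[of u] norm_triangle_sub[of u "L u"] norm_minus_commute[of u "L u"] by linarith
  have "inj L"
    unfolding linear_injective_0[OF \<open>linear L\<close>] by (metis low mult_zero_right norm_le_zero_iff norm_zero)
  then show "bij L"
    using linear_injective_imp_surjective[OF \<open>linear L\<close>] by (simp add: bij_def)
  then show "norm (inv L u) \<le> 2 * norm u"
    using low[of "inv L u"] by (simp add: bij_is_surj surj_f_inv_f)
qed

section \<open>C1 extensions and derivatives along subspaces\<close>

text \<open>The inverse function theorem and the mean value inequality ask for maps on open sets of
  the ambient space, whereas charts are smooth only on subsets of a model subspace. Componentwise
  continuity of the derivative is continuity in operator norm, since the domain is
  finite-dimensional.\<close>

lemma smooth_on_C1_extension:
  fixes f :: "'a::euclidean_space \<Rightarrow> 'b::euclidean_space"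
  assumes sm: "smooth_on S f" and op: "openin (top_of_set F) S" and x0: "x0 \<in> S"
  obtains W g and g' :: "'a \<Rightarrow> 'a \<Rightarrow>\<^sub>L 'b" where "open W" "x0 \<in> W" "F \<inter> W \<subseteq> S"
    "\<And>x. x \<in> F \<inter> W \<Longrightarrow> g x = f x"
    "\<And>x. x \<in> W \<Longrightarrow> (g has_derivative blinfun_apply (g' x)) (at x)"
    "continuous_on W g'"
proof -
  obtain W0 g where W0: "open W0" "x0 \<in> W0" and ck: "\<And>k. Ck_on k g W0"
    and gf: "\<And>y. y \<in> S \<inter> W0 \<Longrightarrow> g y = f y"
    using sm x0 unfolding smooth_on_def by metis
  obtain T where T: "open T" "S = F \<inter> T" using op by (metis openin_open)
  define g' where "g' x = Blinfun (frechet_derivative g (at x))" for x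
  have d: "g differentiable (at x)" if "x \<in> W0" for x
    using ck[of "Suc 0"] that by auto
  then have fd: "(g has_derivative frechet_derivative g (at x)) (at x)" if "x \<in> W0" for x
    using that frechet_derivative_works by blast
  then have app: "blinfun_apply (g' x) = frechet_derivative g (at x)" if "x \<in> W0" for x
    unfolding g'_def using that bounded_linear_Blinfun_apply has_derivative_bounded_linear by blast
  have cv: "continuous_on W0 (\<lambda>x. frechet_derivative g (at x) v)" for v
    using ck[of "Suc 0"] by auto
  have "continuous_on W0 g'"
  proof (rule continuous_on_blinfun_componentwise)
    fix i :: 'a
    show "continuous_on W0 (\<lambda>x. blinfun_apply (g' x) i)"
      using cv[of i] by (rule continuous_on_eq) (simp add: app)
  qed
  then have "continuous_on (W0 \<inter> T) g'" by (rule continuous_on_subset) simp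
  then show thesis
    using that[of "W0 \<inter> T" g g'] W0 T x0 gf fd app by (auto simp: open_Int)
qed

text \<open>The line \<open>x + t *\<^sub>R v\<close> stays in \<open>F\<close>, so derivatives
  along \<open>F\<close> do not see how the map is extended off \<open>F\<close>.\<close>

lemma dir_deriv_eq:
  fixes f :: "'a::euclidean_space \<Rightarrow> 'b::euclidean_space"
  assumes F: "subspace F" and "open W" and x: "x \<in> F \<inter> W" and v: "v \<in> F"
    and gf: "\<And>x. x \<in> F \<inter> W \<Longrightarrow> g x = f x" and g: "(g has_derivative g') (at x)"
  shows "dir_deriv f x v = g' v"
proof -
  have lin: "linear g'" using g has_derivative_linear by blast
  have "((\<lambda>t::real. x + t *\<^sub>R v) has_derivative (\<lambda>t. t *\<^sub>R v)) (at 0)"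
    by (auto intro!: derivative_eq_intros)
  then have "((\<lambda>t::real. g (x + t *\<^sub>R v)) has_derivative (\<lambda>t. g' (t *\<^sub>R v))) (at 0)"
    using has_derivative_compose[of "\<lambda>t::real. x + t *\<^sub>R v" _ 0 UNIV g g'] g by simp
  then have *: "((\<lambda>t::real. g (x + t *\<^sub>R v)) has_vector_derivative g' v) (at 0)"
    unfolding has_vector_derivative_def using lin by (simp add: linear_cmul)
  have "open ((\<lambda>t::real. x + t *\<^sub>R v) -` W)"
    using \<open>open W\<close> by (intro open_vimage continuous_intros) auto
  then have "((\<lambda>t::real. f (x + t *\<^sub>R v)) has_vector_derivative g' v) (at 0)"
    by (rule has_vector_derivative_transform_within_open[OF *])
      (use x v F gf in \<open>auto simp: subspace_add subspace_scale\<close>)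
  then show ?thesis unfolding dir_deriv_def by (rule vector_derivative_at)
qed

section \<open>Charts and tangent vectors\<close>

lemma subspace_projection:
  fixes F :: "'a::euclidean_space set"
  assumes "subspace F"
  obtains \<pi> where "linear \<pi>" "range \<pi> \<subseteq> F" "\<And>x. x \<in> F \<Longrightarrow> \<pi> x = x"
  using linear_exists_left_inverse_on[of "\<lambda>x. x" F] assms by (auto simp: linear_ident)

text \<open>Composing \<open>g\<close> with a projection \<open>\<rho>\<close> onto \<open>E\<close>
  changes nothing on \<open>F\<close>, so the derivative along \<open>F\<close> is also
  \<open>\<rho> (g' v)\<close>.\<close>

lemma derivative_in_subspace:
  fixes g :: "'a::euclidean_space \<Rightarrow> 'b::euclidean_space"
  assumes F: "subspace F" and E: "subspace E" and W: "open W" and x: "x \<in> F \<inter> W" and v: "v \<in> F"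
    and gE: "\<And>x. x \<in> F \<inter> W \<Longrightarrow> g x \<in> E" and g: "(g has_derivative g') (at x)"
  shows "g' v \<in> E"
proof -
  obtain \<rho> where \<rho>: "linear \<rho>" "range \<rho> \<subseteq> E" "\<And>x. x \<in> E \<Longrightarrow> \<rho> x = x"
    using subspace_projection[OF E] by metis
  have "((\<lambda>x. \<rho> (g x)) has_derivative (\<lambda>v. \<rho> (g' v))) (at x)"
    by (rule bounded_linear.has_derivative[OF _ g]) (simp add: \<rho>(1) linear_conv_bounded_linear[symmetric])
  then have "dir_deriv g x v = \<rho> (g' v)"
    by (rule dir_deriv_eq[OF F W x v, rotated]) (use gE \<rho> in auto)
  moreover have "dir_deriv g x v = g' v"
    by (rule dir_deriv_eq[OF F W x v _ g]) simp
  ultimately show ?thesis using \<rho>(2) by auto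
qed

lemma smooth_manifold_subspace: "smooth_manifold M \<Longrightarrow> subspace (model M)"
  by (simp add: smooth_manifold_def)

lemma chart_homeomorphic:
  assumes "smooth_manifold M" "c \<in> atlas M"
  shows "openin (mtop M) (fst c)" "openin (top_of_set (model M)) (snd c ` fst c)"
    "homeomorphic_map (subtopology (mtop M) (fst c)) (top_of_set (snd c ` fst c)) (snd c)"
  using assms by (auto simp: smooth_manifold_def)

lemma chart_topspace:
  assumes "smooth_manifold M" "c \<in> atlas M"
  shows "topspace (subtopology (mtop M) (fst c)) = fst c"
  using openin_subset[OF chart_homeomorphic(1)[OF assms]] by (auto simp: topspace_subtopology)

lemma chart_inj:
  assumes "smooth_manifold M" "c \<in> atlas M"
  shows "inj_on (snd c) (fst c)"
  using chart_homeomorphic(3)[OF assms] chart_topspace[OF assms]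
  by (metis homeomorphic_imp_injective_map)

lemma chart_inv_chart:
  assumes "smooth_manifold M" "c \<in> atlas M" "x \<in> fst c"
  shows "chart_inv c (snd c x) = x"
  using chart_inj[OF assms(1,2)] assms(3) by (simp add: chart_inv_def)

lemma chart_in_model:
  assumes "smooth_manifold M" "c \<in> atlas M" "x \<in> fst c"
  shows "snd c x \<in> model M"
  using openin_subset[OF chart_homeomorphic(2)[OF assms(1,2)]] assms(3) by auto

lemma chart_image_open:
  assumes "smooth_manifold M" "c \<in> atlas M" "openin (mtop M) U" "U \<subseteq> fst c"
  shows "openin (top_of_set (model M)) (snd c ` U)"
proof -
  have "openin (subtopology (mtop M) (fst c)) U"
    using assms(3,4) by (metis inf.absorb1 openin_subtopology)
  then have "openin (top_of_set (snd c ` fst c)) (snd c ` U)"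
    using chart_homeomorphic(3)[OF assms(1,2)] homeomorphic_imp_open_map open_map_def by metis
  then show ?thesis
    using chart_homeomorphic(2)[OF assms(1,2)] openin_trans by metis
qed

lemma chart_preimage_open:
  assumes "smooth_manifold M" "c \<in> atlas M" "open V"
  shows "openin (mtop M) {x \<in> fst c. snd c x \<in> V}"
proof -
  have "continuous_map (subtopology (mtop M) (fst c)) (top_of_set (snd c ` fst c)) (snd c)"
    using chart_homeomorphic(3)[OF assms(1,2)] homeomorphic_imp_continuous_map by blast
  moreover have "openin (top_of_set (snd c ` fst c)) (snd c ` fst c \<inter> V)"
    using \<open>open V\<close> by (auto simp: openin_open)
  ultimately have "openin (subtopology (mtop M) (fst c)) {x \<in> topspace (subtopology (mtop M) (fst c)). snd c x \<in> snd c ` fst c \<inter> V}"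
    by (rule openin_continuous_map_preimage)
  moreover have "{x \<in> topspace (subtopology (mtop M) (fst c)). snd c x \<in> snd c ` fst c \<inter> V} = {x \<in> fst c. snd c x \<in> V}"
    unfolding chart_topspace[OF assms(1,2)] by auto
  ultimately show ?thesis
    using openin_trans_full chart_homeomorphic(1)[OF assms(1,2)] by metis
qed

lemma charts_at_nonempty:
  assumes "smooth_manifold M" "x \<in> topspace (mtop M)"
  shows "\<exists>c. c \<in> charts_at M x"
proof -
  have "x \<in> (\<Union>c\<in>atlas M. fst c)" using assms by (simp add: smooth_manifold_def)
  then show ?thesis unfolding charts_at_def by blast
qed

lemma smooth_map_id:
  assumes "smooth_manifold M"
  shows "smooth_map M M (\<lambda>x. x)"
  using assms by (auto simp: smooth_map_def smooth_manifold_def vimage_def o_def)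

text \<open>Bundles one ambient C1 representative with all that is needed to pass between it, points
  of the manifolds and \<open>dir_deriv\<close>. All nearby \<open>q\<close> are covered, not only
  \<open>snd c x\<close>, because parametrising a leaf requires the derivative on a
  neighbourhood.\<close>

lemma smooth_map_local_representative:
  fixes M :: "('a, 'e::euclidean_space) manifold" and N :: "('b, 'f::euclidean_space) manifold"
  assumes M: "smooth_manifold M" and N: "smooth_manifold N" and f: "smooth_map M N f"
    and c: "c \<in> charts_at M x" and d: "d \<in> charts_at N (f x)"
  obtains W g and g' :: "'e \<Rightarrow> 'e \<Rightarrow>\<^sub>L 'f" where "open W" "snd c x \<in> W"
    "\<And>q. q \<in> W \<Longrightarrow> (g has_derivative blinfun_apply (g' q)) (at q)"
    "continuous_on W g'"
    "\<And>q. q \<in> model M \<inter> W \<Longrightarrow> q \<in> snd c ` fst c"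
    "\<And>q. q \<in> model M \<inter> W \<Longrightarrow> f (chart_inv c q) \<in> fst d"
    "\<And>q. q \<in> model M \<inter> W \<Longrightarrow> g q = snd d (f (chart_inv c q))"
    "\<And>q v. q \<in> model M \<inter> W \<Longrightarrow> v \<in> model M \<Longrightarrow>
       dir_deriv (snd d \<circ> f \<circ> chart_inv c) q v = g' q v"
    "\<And>q v. q \<in> model M \<inter> W \<Longrightarrow> v \<in> model M \<Longrightarrow> g' q v \<in> model N"
proof -
  have cM: "c \<in> atlas M" "x \<in> fst c" and dN: "d \<in> atlas N" "f x \<in> fst d"
    using c d by (auto simp: charts_at_def)
  let ?S = "snd c ` (fst c \<inter> f -` fst d)"
  have cont: "continuous_map (mtop M) (mtop N) f" using f by (simp add: smooth_map_def)
  have "fst c \<inter> f -` fst d = fst c \<inter> {x \<in> topspace (mtop M). f x \<in> fst d}"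
    using openin_subset[OF chart_homeomorphic(1)[OF M cM(1)]] by auto
  then have "openin (mtop M) (fst c \<inter> f -` fst d)"
    using openin_continuous_map_preimage[OF cont chart_homeomorphic(1)[OF N dN(1)]]
      chart_homeomorphic(1)[OF M cM(1)] by (simp add: openin_Int)
  then have op: "openin (top_of_set (model M)) ?S"
    by (intro chart_image_open[OF M cM(1)]) auto
  have "smooth_on ?S (snd d \<circ> f \<circ> chart_inv c)"
    using f cM dN by (simp add: smooth_map_def)
  then obtain W g and g' :: "'e \<Rightarrow> 'e \<Rightarrow>\<^sub>L 'f" where W: "open W" "snd c x \<in> W" and sub: "model M \<inter> W \<subseteq> ?S"
    and gf: "\<And>q. q \<in> model M \<inter> W \<Longrightarrow> g q = (snd d \<circ> f \<circ> chart_inv c) q"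
    and g': "\<And>q. q \<in> W \<Longrightarrow> (g has_derivative blinfun_apply (g' q)) (at q)" and cg': "continuous_on W g'"
    by (rule smooth_on_C1_extension[OF _ op, of _ "snd c x"]) (use cM dN in auto)
  have fd: "f (chart_inv c q) \<in> fst d" if "q \<in> model M \<inter> W" for q
    using sub that chart_inv_chart[OF M cM(1)] by auto
  show thesis
  proof (rule that[OF W g' cg'])
    fix q assume q: "q \<in> model M \<inter> W"
    show "q \<in> snd c ` fst c" using sub q by auto
    show "f (chart_inv c q) \<in> fst d" by (rule fd[OF q])
    show "g q = snd d (f (chart_inv c q))" using gf[OF q] by simp
  next
    fix q v assume q: "q \<in> model M \<inter> W" and v: "v \<in> model M"
    show "dir_deriv (snd d \<circ> f \<circ> chart_inv c) q v = g' q v"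
      by (rule dir_deriv_eq[OF smooth_manifold_subspace[OF M] W(1) q v gf]) (use g' q in auto)
    show "g' q v \<in> model N"
      by (rule derivative_in_subspace[OF smooth_manifold_subspace[OF M] smooth_manifold_subspace[OF N] W(1) q v _ g'])
        (use gf fd q chart_in_model[OF N dN(1)] in auto)
  qed auto
qed

text \<open>The inner derivative lands in \<open>model N\<close>, where the outer directional
  derivative is independent of the extension, so the ambient chain rule descends. With identity maps
  inserted it is the change of charts for tangent vectors.\<close>

lemma dir_deriv_chart_chain:
  fixes M :: "('a, 'e::euclidean_space) manifold" and N :: "('b, 'f::euclidean_space) manifold"
    and Q :: "('c, 'g::euclidean_space) manifold"
  assumes M: "smooth_manifold M" and N: "smooth_manifold N" and Q: "smooth_manifold Q"
    and f: "smooth_map M N f" and h: "smooth_map N Q h"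
    and c: "c \<in> charts_at M x" and d: "d \<in> charts_at N (f x)" and e: "e \<in> charts_at Q (h (f x))"
    and v: "v \<in> model M"
  shows "dir_deriv (snd e \<circ> (\<lambda>x. h (f x)) \<circ> chart_inv c) (snd c x) v =
    dir_deriv (snd e \<circ> h \<circ> chart_inv d) (snd d (f x)) (dir_deriv (snd d \<circ> f \<circ> chart_inv c) (snd c x) v)"
proof -
  have cM: "c \<in> atlas M" "x \<in> fst c" and dN: "d \<in> atlas N" "f x \<in> fst d"
    using c d by (auto simp: charts_at_def)
  obtain W1 g1 and g1' :: "'e \<Rightarrow> 'e \<Rightarrow>\<^sub>L 'f" where W1: "open W1" "snd c x \<in> W1"
    and g1': "\<And>q. q \<in> W1 \<Longrightarrow> (g1 has_derivative blinfun_apply (g1' q)) (at q)"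
    and fd: "\<And>q. q \<in> model M \<inter> W1 \<Longrightarrow> f (chart_inv c q) \<in> fst d"
    and g1: "\<And>q. q \<in> model M \<inter> W1 \<Longrightarrow> g1 q = snd d (f (chart_inv c q))"
    and dd1: "\<And>q v. q \<in> model M \<inter> W1 \<Longrightarrow> v \<in> model M \<Longrightarrow> dir_deriv (snd d \<circ> f \<circ> chart_inv c) q v = g1' q v"
    and m1: "\<And>q v. q \<in> model M \<inter> W1 \<Longrightarrow> v \<in> model M \<Longrightarrow> g1' q v \<in> model N"
    by (rule smooth_map_local_representative[OF M N f c d]) blast
  obtain W2 g2 and g2' :: "'f \<Rightarrow> 'f \<Rightarrow>\<^sub>L 'g" where W2: "open W2" "snd d (f x) \<in> W2"
    and g2': "\<And>q. q \<in> W2 \<Longrightarrow> (g2 has_derivative blinfun_apply (g2' q)) (at q)"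
    and g2: "\<And>q. q \<in> model N \<inter> W2 \<Longrightarrow> g2 q = snd e (h (chart_inv d q))"
    and dd2: "\<And>q v. q \<in> model N \<inter> W2 \<Longrightarrow> v \<in> model N \<Longrightarrow> dir_deriv (snd e \<circ> h \<circ> chart_inv d) q v = g2' q v"
    by (rule smooth_map_local_representative[OF N Q h d e]) blast
  have x: "snd c x \<in> model M \<inter> W1" using W1(2) chart_in_model[OF M cM] by simp
  have fx: "snd d (f x) \<in> model N \<inter> W2" using W2(2) chart_in_model[OF N dN] by simp
  have g1x: "g1 (snd c x) = snd d (f x)" using g1[OF x] chart_inv_chart[OF M cM] by simp
  have "continuous_on W1 g1"
    by (meson continuous_at_imp_continuous_on g1' has_derivative_continuous)
  then have op: "open (W1 \<inter> g1 -` W2)"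
    using W1(1) W2(1) continuous_open_preimage by blast
  have der: "((\<lambda>q. g2 (g1 q)) has_derivative (\<lambda>v. g2' (g1 (snd c x)) (g1' (snd c x) v))) (at (snd c x))"
    by (rule has_derivative_compose[of g1 _ _ UNIV g2]) (use g1' g2' x fx g1x in auto)
  have "dir_deriv (snd e \<circ> (\<lambda>x. h (f x)) \<circ> chart_inv c) (snd c x) v = g2' (g1 (snd c x)) (g1' (snd c x) v)"
  proof (rule dir_deriv_eq[OF smooth_manifold_subspace[OF M] op _ v _ der])
    show "snd c x \<in> model M \<inter> (W1 \<inter> g1 -` W2)" using x fx g1x by simp
    fix q assume q: "q \<in> model M \<inter> (W1 \<inter> g1 -` W2)"
    then have "g1 q = snd d (f (chart_inv c q))" "f (chart_inv c q) \<in> fst d" using g1 fd by auto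
    then show "g2 (g1 q) = (snd e \<circ> (\<lambda>x. h (f x)) \<circ> chart_inv c) q"
      using q g2[of "g1 q"] chart_in_model[OF N dN(1)] chart_inv_chart[OF N dN(1)] by simp
  qed
  then show ?thesis
    using dd1[OF x v] dd2[OF fx m1[OF x v]] g1x by simp
qed

lemma dir_deriv_id_chart:
  fixes M :: "('a, 'e::euclidean_space) manifold"
  assumes M: "smooth_manifold M" and c: "c \<in> charts_at M x" and v: "v \<in> model M"
  shows "dir_deriv (snd c \<circ> chart_inv c) (snd c x) v = v"
proof -
  have cM: "c \<in> atlas M" "x \<in> fst c" using c by (auto simp: charts_at_def)
  obtain T where T: "open T" "snd c ` fst c = model M \<inter> T"
    using chart_homeomorphic(2)[OF M cM(1)] by (metis openin_open)
  show ?thesis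
  proof (rule dir_deriv_eq[OF smooth_manifold_subspace[OF M] T(1) _ v, of _ "\<lambda>q. q"])
    fix q assume "q \<in> model M \<inter> T"
    then have "q \<in> snd c ` fst c" using T by simp
    then show "q = (snd c \<circ> chart_inv c) q" by (auto simp: chart_inv_chart[OF M cM(1)])
  qed (use cM T in auto)
qed

text \<open>The chart transitions spread \<open>u\<close> to all charts around \<open>x\<close>;
  compatibility of the resulting family is the chain rule.\<close>

lemma tangent_vector_with_coordinate:
  fixes M :: "('a, 'e::euclidean_space) manifold"
  assumes M: "smooth_manifold M" and c: "c \<in> charts_at M x" and u: "u \<in> model M"
  obtains v where "v \<in> tangent_space M x" "v c = u"
proof -
  define v where "v d = (if d \<in> charts_at M x then dir_deriv (snd d \<circ> chart_inv c) (snd c x) u else 0)" for d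
  note id = smooth_map_id[OF M]
  have cM: "c \<in> atlas M" "x \<in> fst c" using c by (auto simp: charts_at_def)
  have 1: "v c = u" using dir_deriv_id_chart[OF M c u] c by (simp add: v_def)
  have 2: "v \<in> tangent_space M x"
    unfolding tangent_space_def mem_Collect_eq
  proof (intro conjI ballI allI impI)
    fix d assume d: "d \<in> charts_at M x"
    obtain W and g' :: "'e \<Rightarrow> 'e \<Rightarrow>\<^sub>L 'e" where W: "snd c x \<in> W"
      and dd: "\<And>q v. q \<in> model M \<inter> W \<Longrightarrow> v \<in> model M \<Longrightarrow> dir_deriv (snd d \<circ> (\<lambda>x. x) \<circ> chart_inv c) q v = g' q v"
      and m: "\<And>q v. q \<in> model M \<inter> W \<Longrightarrow> v \<in> model M \<Longrightarrow> g' q v \<in> model M"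
      by (rule smooth_map_local_representative[OF M M id c d]) blast
    show "v d \<in> model M"
      using d dd[of "snd c x" u] m[of "snd c x" u] W chart_in_model[OF M cM] u
      by (simp add: v_def o_def)
  next
    fix d e assume d: "d \<in> charts_at M x" and e: "e \<in> charts_at M x"
    show "v e = dir_deriv (snd e \<circ> chart_inv d) (snd d x) (v d)"
      using dir_deriv_chart_chain[OF M M M id id c d e u] d e by (simp add: v_def o_def)
  qed (simp add: v_def)
  show thesis by (rule that[OF 2 1])
qed

lemma tangent_spaceD:
  assumes "v \<in> tangent_space M x" "c \<in> charts_at M x"
  shows "v c \<in> model M"
    "d \<in> charts_at M x \<Longrightarrow> v d = dir_deriv (snd d \<circ> chart_inv c) (snd c x) (v c)"
proof -
  have 1: "\<forall>c\<in>charts_at M x. v c \<in> model M"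
    and 2: "\<forall>c\<in>charts_at M x. \<forall>d\<in>charts_at M x. v d = dir_deriv (snd d \<circ> chart_inv c) (snd c x) (v c)"
    using assms(1) unfolding tangent_space_def mem_Collect_eq by (rule conjunct1, rule conjunct1[OF conjunct2])
  show "v c \<in> model M" by (rule bspec[OF 1 assms(2)])
  show "v d = dir_deriv (snd d \<circ> chart_inv c) (snd c x) (v c)" if "d \<in> charts_at M x"
    by (rule bspec[OF bspec[OF 2 assms(2)] that])
qed

lemma tangent_map_in_chart:
  assumes M: "smooth_manifold M" and N: "smooth_manifold N" and f: "smooth_map M N f"
    and c: "c \<in> charts_at M x" and d: "d \<in> charts_at N (f x)" and v: "v \<in> tangent_space M x"
  shows "tangent_map M N f x v d = dir_deriv (snd d \<circ> f \<circ> chart_inv c) (snd c x) (v c)"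
proof -
  define c0 where "c0 = (SOME c. c \<in> charts_at M x)"
  have c0: "c0 \<in> charts_at M x" unfolding c0_def using c by (rule someI)
  have "v c0 \<in> model M" "v c = dir_deriv (snd c \<circ> chart_inv c0) (snd c0 x) (v c0)"
    using tangent_spaceD[OF v c0] c by auto
  then have "dir_deriv (snd d \<circ> f \<circ> chart_inv c0) (snd c0 x) (v c0) =
      dir_deriv (snd d \<circ> f \<circ> chart_inv c) (snd c x) (v c)"
    using dir_deriv_chart_chain[OF M M N smooth_map_id[OF M] f c0 c d] by (simp add: o_def)
  then show ?thesis using d by (simp add: tangent_map_def Let_def c0_def)
qed

text \<open>Tangent vectors of \<open>P\<close> are families over all charts, while the estimates
  below work in one chart. Injectivity survives the restriction: images that agree in the chart
  \<open>d\<close> agree in every chart by the chain rule, and then injectivity of the full tangent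
  map applies.\<close>

lemma integral_manifold_tangent_in_chart:
  fixes P :: "('a, 'e::euclidean_space) manifold"
  assumes P: "smooth_manifold P" and N: "connected_integral_manifold P D N"
    and c: "c \<in> charts_at N x" and d: "d \<in> charts_at P x"
  shows "(\<lambda>X. X d) ` D x = dir_deriv (snd d \<circ> (\<lambda>x. x) \<circ> chart_inv c) (snd c x) ` model N" (is "_ = ?f ` _")
    and "inj_on (dir_deriv (snd d \<circ> (\<lambda>x. x) \<circ> chart_inv c) (snd c x)) (model N)"
proof -
  have Nm: "smooth_manifold N" and im: "immersion N P (\<lambda>x. x)"
    and DN: "\<And>x. x \<in> topspace (mtop N) \<Longrightarrow> tangent_map N P (\<lambda>x. x) x ` tangent_space N x = D x"
    using N by (auto simp: connected_integral_manifold_def immersed_submanifold_def)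
  have sm: "smooth_map N P (\<lambda>x. x)" using im by (simp add: immersion_def)
  have x: "x \<in> topspace (mtop N)"
    using c openin_subset[OF chart_homeomorphic(1)[OF Nm, of c]] unfolding charts_at_def by blast
  have inj: "inj_on (tangent_map N P (\<lambda>x. x) x) (tangent_space N x)"
    using im x by (simp add: immersion_def)
  note tm = tangent_map_in_chart[OF Nm P sm c]
  have vc: "(\<lambda>v. v c) ` tangent_space N x = model N"
  proof
    show "(\<lambda>v. v c) ` tangent_space N x \<subseteq> model N"
      using tangent_spaceD(1)[OF _ c] by blast
    show "model N \<subseteq> (\<lambda>v. v c) ` tangent_space N x"
    proof
      fix u assume "u \<in> model N"
      then obtain v where "v \<in> tangent_space N x" "v c = u"
        by (rule tangent_vector_with_coordinate[OF Nm c])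
      then show "u \<in> (\<lambda>v. v c) ` tangent_space N x" by (auto intro: rev_image_eqI)
    qed
  qed
  have "(\<lambda>X. X d) ` D x = (\<lambda>v. tangent_map N P (\<lambda>x. x) x v d) ` tangent_space N x"
    by (simp add: DN[OF x, symmetric] image_image)
  also have "\<dots> = (\<lambda>v. ?f (v c)) ` tangent_space N x"
    by (intro image_cong refl tm d)
  also have "\<dots> = ?f ` model N"
    unfolding vc[symmetric] image_image ..
  finally show "(\<lambda>X. X d) ` D x = ?f ` model N" .
  show "inj_on ?f (model N)"
  proof (rule inj_onI)
    fix u u' assume u: "u \<in> model N" and u': "u' \<in> model N" and eq: "?f u = ?f u'"
    obtain v v' where v: "v \<in> tangent_space N x" "v c = u" and v': "v' \<in> tangent_space N x" "v' c = u'"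
      using tangent_vector_with_coordinate[OF Nm c] u u' by metis
    have "tangent_map N P (\<lambda>x. x) x v e = tangent_map N P (\<lambda>x. x) x v' e" for e
    proof (cases "e \<in> charts_at P x")
      case True
      have "dir_deriv (snd e \<circ> (\<lambda>x. x) \<circ> chart_inv c) (snd c x) u = dir_deriv (snd e \<circ> (\<lambda>x. x) \<circ> chart_inv c) (snd c x) u'"
        using dir_deriv_chart_chain[OF Nm P P sm smooth_map_id[OF P] c d True u]
          dir_deriv_chart_chain[OF Nm P P sm smooth_map_id[OF P] c d True u'] eq by simp
      then show ?thesis using tm[OF True] v v' by simp
    next
      case False
      then show ?thesis by (simp add: tangent_map_def Let_def)
    qed
    then have "v = v'" using inj v v' by (meson ext inj_onD)
    then show "u = u'" using v v' by simp
  qed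
qed

section \<open>Adapted parametrisations of leaves\<close>

text \<open>\<open>B\<close> maps the coordinates of \<open>P\<close> linearly to a model \<open>F\<close> of the leaf, and \<open>\<phi>\<close> parametrises the leaf near
  \<open>p\<close> as a section of \<open>B\<close>, with derivative \<open>A\<close>.  Outside \<open>F\<close> the values of \<open>\<phi>\<close> are irrelevant; they only
  allow derivatives in the ambient space.\<close>

locale leaf_parametrisation =
  fixes P :: "('a, 'e::euclidean_space) manifold" and D :: "'a \<Rightarrow> ('a, 'e) tangent set"
    and N :: "('a, 'e) manifold" and p :: 'a and d :: "('a, 'e) chart"
    and F :: "'e set" and B \<phi> :: "'e \<Rightarrow> 'e" and W :: "'e set" and A :: "'e \<Rightarrow> 'e \<Rightarrow> 'e" and a :: real
  assumes P: "smooth_manifold P" and N: "connected_integral_manifold P D N"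
    and p: "p \<in> topspace (mtop N)" and d: "d \<in> charts_at P p"
    and F: "subspace F" and dim_F: "dim F = mdim N" and B: "linear B" and range_B: "range B \<subseteq> F"
    and W: "open W" and base_W: "B (snd d p) \<in> W" and \<phi>_base: "\<phi> (B (snd d p)) = snd d p"
    and \<phi>_deriv: "\<And>s. s \<in> W \<Longrightarrow> (\<phi> has_derivative A s) (at s)"
    and A_bound: "\<And>s u. s \<in> W \<Longrightarrow> norm (A s u) \<le> a * norm u"
    and \<phi>_in_leaf: "\<And>s. s \<in> W \<inter> F \<Longrightarrow> chart_inv d (\<phi> s) \<in> topspace (mtop N) \<inter> fst d"
    and chart_\<phi>: "\<And>s. s \<in> W \<inter> F \<Longrightarrow> snd d (chart_inv d (\<phi> s)) = \<phi> s"
    and A_B: "\<And>s X. s \<in> W \<inter> F \<Longrightarrow> X \<in> D (chart_inv d (\<phi> s)) \<Longrightarrow> A s (B (X d)) = X d"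
    and A_in_D: "\<And>s e. s \<in> W \<inter> F \<Longrightarrow> e \<in> F \<Longrightarrow> A s e \<in> (\<lambda>X. X d) ` D (chart_inv d (\<phi> s))"
    and B_A: "\<And>s e. s \<in> W \<inter> F \<Longrightarrow> e \<in> F \<Longrightarrow> B (A s e) = e"
    and \<phi>_open: "\<And>V. open V \<Longrightarrow> V \<subseteq> W \<Longrightarrow> openin (mtop N) ((\<lambda>s. chart_inv d (\<phi> s)) ` (V \<inter> F))"

text \<open>Let \<open>g\<close> express the inclusion of the leaf in charts and let
  \<open>B\<close> be a linear left inverse of its derivative at \<open>x0\<close>. Then
  \<open>B \<circ> g\<close> is a local diffeomorphism of the model \<open>F\<close> at
  \<open>x0\<close>, and reparametrising \<open>g\<close> by its inverse \<open>G\<close> gives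
  \<open>\<phi>\<close>.\<close>

lemma leaf_parametrisation_exists:
  fixes P :: "('a, 'e::euclidean_space) manifold"
  assumes P: "smooth_manifold P" and N: "connected_integral_manifold P D N"
    and p: "p \<in> topspace (mtop N)" and d: "d \<in> charts_at P p"
  obtains F :: "'e set" and B \<phi> W A a where "leaf_parametrisation P D N p d F B \<phi> W A a"
proof -
  have Nm: "smooth_manifold N" and sm: "smooth_map N P (\<lambda>x. x)"
    using N by (auto simp: connected_integral_manifold_def immersed_submanifold_def immersion_def)
  obtain c where c: "c \<in> charts_at N p" using charts_at_nonempty[OF Nm p] by blast
  then have cN: "c \<in> atlas N" "p \<in> fst c" by (auto simp: charts_at_def)
  have dP: "d \<in> atlas P" "p \<in> fst d" using d by (auto simp: charts_at_def)
  define F where "F = model N"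
  have F: "subspace F" unfolding F_def by (rule smooth_manifold_subspace[OF Nm])
  define x0 where "x0 = snd c p"
  obtain W1 g and g' :: "'e \<Rightarrow> 'e \<Rightarrow>\<^sub>L 'e" where W1: "open W1" "x0 \<in> W1"
    and g': "\<And>q. q \<in> W1 \<Longrightarrow> (g has_derivative blinfun_apply (g' q)) (at q)"
    and cg': "continuous_on W1 g'"
    and qc: "\<And>q. q \<in> F \<inter> W1 \<Longrightarrow> q \<in> snd c ` fst c"
    and qd: "\<And>q. q \<in> F \<inter> W1 \<Longrightarrow> chart_inv c q \<in> fst d"
    and gq: "\<And>q. q \<in> F \<inter> W1 \<Longrightarrow> g q = snd d (chart_inv c q)"
    and dd: "\<And>q v. q \<in> F \<inter> W1 \<Longrightarrow> v \<in> F \<Longrightarrow> dir_deriv (snd d \<circ> (\<lambda>x. x) \<circ> chart_inv c) q v = g' q v"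
    unfolding x0_def F_def by (rule smooth_map_local_representative[OF Nm P sm c d]) blast
  have x0F: "x0 \<in> F" unfolding x0_def F_def by (rule chart_in_model[OF Nm cN])
  have gx0: "g x0 = snd d p" using gq[of x0] x0F W1 chart_inv_chart[OF Nm cN] by (simp add: x0_def)
  have ccq: "chart_inv c q \<in> fst c" "snd c (chart_inv c q) = q" if "q \<in> F \<inter> W1" for q
    using qc[OF that] chart_inv_chart[OF Nm cN(1)] by auto
  have Dq: "(\<lambda>X. X d) ` D (chart_inv c q) = g' q ` F" if q: "q \<in> F \<inter> W1" for q
  proof -
    have "c \<in> charts_at N (chart_inv c q)" "d \<in> charts_at P (chart_inv c q)"
      using ccq[OF q] qd[OF q] cN dP by (auto simp: charts_at_def)
    from integral_manifold_tangent_in_chart(1)[OF P N this]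
    have "(\<lambda>X. X d) ` D (chart_inv c q) = dir_deriv (snd d \<circ> (\<lambda>x. x) \<circ> chart_inv c) q ` F"
      by (simp add: ccq[OF q] F_def)
    also have "\<dots> = g' q ` F" by (rule image_cong) (use dd q in auto)
    finally show ?thesis .
  qed
  have "inj_on (dir_deriv (snd d \<circ> (\<lambda>x. x) \<circ> chart_inv c) x0) F"
    unfolding x0_def F_def by (rule integral_manifold_tangent_in_chart(2)[OF P N c d])
  then have "inj_on (g' x0) F" using dd[of x0] x0F W1 by (simp add: inj_on_def)
  then obtain B where B: "linear B" "range B \<subseteq> F" "\<And>v. v \<in> F \<Longrightarrow> B (g' x0 v) = v"
    using linear_exists_left_inverse_on[OF bounded_linear.linear[OF blinfun.bounded_linear_right[of "g' x0"]] F]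
    by metis
  obtain \<pi> where \<pi>: "linear \<pi>" "range \<pi> \<subseteq> F" "\<And>x. x \<in> F \<Longrightarrow> \<pi> x = x"
    using subspace_projection[OF F] by metis
  have \<pi>F: "\<pi> q \<in> F" for q using \<pi>(2) by auto
  define Bb where "Bb = Blinfun B"
  define pb where "pb = Blinfun \<pi>"
  have Bb: "blinfun_apply Bb = B" and pb: "blinfun_apply pb = \<pi>"
    using B(1) \<pi>(1) by (simp_all add: Bb_def pb_def bounded_linear_Blinfun_apply linear_conv_bounded_linear)
  \<comment> \<open>\<open>\<Phi>\<close> extends the map \<open>B \<circ> g\<close> of \<open>F\<close> to the ambient space with derivative the identity at \<open>x0\<close>, so the inverse function theorem applies.\<close>
  define \<Phi> where "\<Phi> q = B (g (\<pi> q)) + q - \<pi> q" for q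
  define \<Phi>' where "\<Phi>' q = (Bb o\<^sub>L (g' (\<pi> q) o\<^sub>L pb)) + id_blinfun - pb" for q
  have \<Phi>'_app: "\<Phi>' q u = B (g' (\<pi> q) (\<pi> u)) + u - \<pi> u" for q u
    by (simp add: \<Phi>'_def blinfun.bilinear_simps Bb pb)
  have c\<pi>: "continuous_on S \<pi>" for S
    using \<pi>(1) by (simp add: linear_continuous_on linear_conv_bounded_linear)
  define U1 where "U1 = \<pi> -` W1"
  have U1: "open U1" unfolding U1_def by (rule open_vimage[OF W1(1) c\<pi>])
  have x0U1: "x0 \<in> U1" using W1 x0F \<pi> by (simp add: U1_def)
  have cg\<pi>: "continuous_on U1 (\<lambda>q. g' (\<pi> q))"
    by (rule continuous_on_compose2[OF cg' c\<pi>]) (auto simp: U1_def)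
  have c\<Phi>': "continuous_on U1 \<Phi>'"
    unfolding \<Phi>'_def
    by (intro continuous_intros bounded_bilinear.continuous_on[OF bounded_bilinear_blinfun_compose] cg\<pi>)
  have \<Phi>'x0: "\<Phi>' x0 = id_blinfun"
    by (rule blinfun_eqI) (simp add: \<Phi>'_app \<pi>(3)[OF x0F] B(3)[OF \<pi>F])
  \<comment> \<open>The first condition keeps \<open>\<Phi>'\<close> within 1/2 of the identity, so
    that its inverse has norm at most 2; the second bounds \<open>g'\<close>. Together they give the
    uniform constant for \<open>A\<close>.\<close>
  define U where "U = (U1 \<inter> \<Phi>' -` ball id_blinfun (1/2)) \<inter> (U1 \<inter> (\<lambda>q. g' (\<pi> q)) -` ball (g' x0) 1)"
  have U: "open U" unfolding U_def
    by (intro open_Int continuous_open_preimage[OF c\<Phi>' U1] continuous_open_preimage[OF cg\<pi> U1] open_ball)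
  have x0U: "x0 \<in> U" using x0U1 \<Phi>'x0 \<pi>(3)[OF x0F] by (simp add: U_def)
  have d\<Phi>: "(\<Phi> has_derivative blinfun_apply (\<Phi>' q)) (at q)" if "q \<in> U" for q
  proof -
    have 1: "(\<pi> has_derivative \<pi>) (at q)"
      using \<pi>(1) by (simp add: linear_conv_bounded_linear bounded_linear_imp_has_derivative)
    have "((\<lambda>q. g (\<pi> q)) has_derivative (\<lambda>u. g' (\<pi> q) (\<pi> u))) (at q)"
      using that by (intro has_derivative_compose[OF 1] g') (auto simp: U_def U1_def)
    then have "((\<lambda>q. B (g (\<pi> q))) has_derivative (\<lambda>u. B (g' (\<pi> q) (\<pi> u)))) (at q)"
      by (rule bounded_linear.has_derivative[OF B(1)[unfolded linear_conv_bounded_linear]])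
    from has_derivative_diff[OF has_derivative_add[OF this has_derivative_ident] 1]
    show ?thesis
      unfolding \<Phi>_def[abs_def] by (rule has_derivative_eq_rhs) (simp add: \<Phi>'_app fun_eq_iff)
  qed
  have UU1: "U \<subseteq> U1" by (auto simp: U_def)
  have id\<Phi>': "id_blinfun o\<^sub>L \<Phi>' x0 = id_blinfun" by (rule blinfun_eqI) (simp add: \<Phi>'x0)
  obtain U' V G G' where U': "open U'" "U' \<subseteq> U" "x0 \<in> U'" and V: "open V" "\<Phi> x0 \<in> V"
    and hom: "homeomorphism U' V \<Phi> G"
    and dG: "\<And>y. y \<in> V \<Longrightarrow> (G has_derivative (G' y)) (at y)"
    and G': "\<And>y. y \<in> V \<Longrightarrow> G' y = inv (blinfun_apply (\<Phi>' (G y)))"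
    and bij: "\<And>y. y \<in> V \<Longrightarrow> bij (blinfun_apply (\<Phi>' (G y)))"
  proof (rule inverse_function_theorem[OF U d\<Phi> continuous_on_subset[OF c\<Phi>' UU1] x0U id\<Phi>'])
    fix U' V G G'
    assume "open U'" "U' \<subseteq> U" "x0 \<in> U'" "open V" "\<Phi> x0 \<in> V" "homeomorphism U' V \<Phi> G"
      "\<And>y. y \<in> V \<Longrightarrow> (G has_derivative (G' y)) (at y)"
      "\<And>y. y \<in> V \<Longrightarrow> G' y = inv (blinfun_apply (\<Phi>' (G y)))"
      "\<And>y. y \<in> V \<Longrightarrow> bij (blinfun_apply (\<Phi>' (G y)))"
    then show thesis by (rule that[of U' V G G'])
  qed
  have GV: "G s \<in> U'" "\<Phi> (G s) = s" if "s \<in> V" for s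
    using hom that by (auto simp: homeomorphism_def)
  have GU: "G (\<Phi> q) = q" "\<Phi> q \<in> V" if "q \<in> U'" for q
    using hom that by (auto simp: homeomorphism_def)
  have BF: "B u \<in> F" for u using B(2) by auto
  have GF: "G s \<in> F \<inter> W1" if "s \<in> V \<inter> F" for s
  proof -
    \<comment> \<open>The equation \<open>\<Phi> (G s) = s\<close>, solved for \<open>G s\<close>,
      has only terms in \<open>F\<close> on the right.\<close>
    have "G s = s - B (g (\<pi> (G s))) + \<pi> (G s)"
      using GV(2)[of s] that by (simp add: \<Phi>_def algebra_simps)
    also have "\<dots> \<in> F" using that BF \<pi>F F by (intro subspace_add subspace_diff) auto
    finally have "G s \<in> F" .
    moreover have "\<pi> (G s) \<in> W1" using GV(1)[of s] U'(2) that by (auto simp: U_def U1_def)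
    ultimately show ?thesis using \<pi>(3) by simp
  qed
  have \<Phi>F: "\<Phi> q = B (g q)" if "q \<in> F" for q using \<pi>(3)[OF that] by (simp add: \<Phi>_def)
  have \<Phi>'F: "\<Phi>' q u = B (g' q u)" if "q \<in> F" "u \<in> F" for q u
    using \<pi>(3) that by (simp add: \<Phi>'_app)
  define \<phi> where "\<phi> s = g (\<pi> (G s))" for s
  define A where "A s u = g' (\<pi> (G s)) (\<pi> (G' s u))" for s u
  have \<phi>: "\<phi> s = g (G s)" if "s \<in> V \<inter> F" for s
    using GF[OF that] \<pi>(3) by (simp add: \<phi>_def)
  have \<phi>c: "\<phi> s = snd d (chart_inv c (G s))" if "s \<in> V \<inter> F" for s
    using \<phi>[OF that] gq[OF GF[OF that]] by simp
  have d\<phi>: "chart_inv d (\<phi> s) = chart_inv c (G s)" if "s \<in> V \<inter> F" for s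
    using \<phi>c[OF that] chart_inv_chart[OF P dP(1) qd[OF GF[OF that]]] by simp
  have s0: "B (snd d p) = \<Phi> x0" by (simp add: \<Phi>F[OF x0F] gx0)
  \<comment> \<open>The constant for \<open>A\<close> multiplies the bounds for \<open>g'\<close>,
    for the projection \<open>\<pi>\<close> and for the inverse of \<open>\<Phi>'\<close>.\<close>
  show thesis
  proof (rule that[of F B \<phi> V A "(norm (g' x0) + 1) * (norm pb * 2)", OF leaf_parametrisation.intro])
    show "dim F = mdim N" by (simp add: F_def mdim_def)
    show "B (snd d p) \<in> V" using V(2) s0 by simp
    show "\<phi> (B (snd d p)) = snd d p" by (simp add: s0 \<phi>_def GU(1)[OF U'(3)] \<pi>(3)[OF x0F] gx0)
  next
    fix s assume s: "s \<in> V"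
    have \<pi>G: "\<pi> (G s) \<in> W1" using GV(1)[OF s] U'(2) by (auto simp: U_def U1_def)
    have "(\<pi> has_derivative \<pi>) (at (G s))"
      using \<pi>(1) by (simp add: linear_conv_bounded_linear bounded_linear_imp_has_derivative)
    then have "((\<lambda>s. \<pi> (G s)) has_derivative (\<lambda>u. \<pi> (G' s u))) (at s)"
      by (rule has_derivative_compose[OF dG[OF s]])
    then show "(\<phi> has_derivative A s) (at s)"
      unfolding \<phi>_def[abs_def] A_def[abs_def]
      by (rule has_derivative_compose) (rule g'[OF \<pi>G])
  next
    fix s u assume s: "s \<in> V"
    have GU: "G s \<in> U" using GV(1)[OF s] U'(2) by auto
    have near: "norm (\<Phi>' (G s) v - v) \<le> norm v / 2" for v
    proof -
      have "norm ((\<Phi>' (G s) - id_blinfun) v) \<le> norm (\<Phi>' (G s) - id_blinfun) * norm v"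
        by (rule norm_blinfun)
      also have "\<dots> \<le> 1/2 * norm v"
        using GU by (intro mult_right_mono) (auto simp: U_def dist_norm norm_minus_commute)
      finally show ?thesis by (simp add: blinfun.bilinear_simps)
    qed
    have G'b: "norm (G' s u) \<le> 2 * norm u" unfolding G'[OF s]
      by (rule perturbed_identity(2)[OF _ near]) (simp add: blinfun.bounded_linear_right bounded_linear.linear)
    have gb: "norm (g' (\<pi> (G s))) \<le> norm (g' x0) + 1"
      using GU norm_triangle_sub[of "g' (\<pi> (G s))" "g' x0"]
      by (auto simp: U_def dist_norm norm_minus_commute)
    have "norm (A s u) \<le> norm (g' (\<pi> (G s))) * norm (pb (G' s u))"
      unfolding A_def pb[symmetric] by (rule norm_blinfun)
    also have "\<dots> \<le> (norm (g' x0) + 1) * (norm pb * (2 * norm u))"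
      by (intro mult_mono gb order_trans[OF norm_blinfun] G'b mult_left_mono) auto
    finally show "norm (A s u) \<le> (norm (g' x0) + 1) * (norm pb * 2) * norm u" by (simp add: mult.assoc)
  next
    fix s assume s: "s \<in> V \<inter> F"
    have "chart_inv c (G s) \<in> topspace (mtop N)"
      using ccq(1)[OF GF[OF s]] openin_subset[OF chart_homeomorphic(1)[OF Nm cN(1)]] by auto
    then show "chart_inv d (\<phi> s) \<in> topspace (mtop N) \<inter> fst d"
      using d\<phi>[OF s] qd[OF GF[OF s]] by simp
    show "snd d (chart_inv d (\<phi> s)) = \<phi> s" using d\<phi>[OF s] \<phi>c[OF s] by simp
  next
    fix s X assume s: "s \<in> V \<inter> F" and X: "X \<in> D (chart_inv d (\<phi> s))"
    have "X d \<in> g' (G s) ` F" using X Dq[OF GF[OF s]] d\<phi>[OF s] by auto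
    then obtain u where u: "u \<in> F" "X d = g' (G s) u" by blast
    \<comment> \<open>\<open>X d\<close> is the image of \<open>u\<close> under \<open>g'\<close>,
      and on \<open>F\<close> the map \<open>\<Phi>'\<close> is \<open>B\<close> after
      \<open>g'\<close>; its inverse therefore recovers \<open>u\<close>.\<close>
    have "G' s (B (X d)) = u"
      using \<Phi>'F[of "G s" u] GF[OF s] u G'[of s] bij[of s] s by (metis IntD1 bij_inv_eq_iff)
    then show "A s (B (X d)) = X d"
      using u \<pi>(3) GF[OF s] by (simp add: A_def)
  next
    fix s e assume s: "s \<in> V \<inter> F" and e: "e \<in> F"
    have "\<Phi>' (G s) (G' s e) = e" using G'[of s] bij[of s] s by (metis IntD1 bij_inv_eq_iff)
    then have "G' s e = e - B (g' (\<pi> (G s)) (\<pi> (G' s e))) + \<pi> (G' s e)"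
      by (simp add: \<Phi>'_app algebra_simps)
    also have "\<dots> \<in> F" using e BF \<pi>F F by (intro subspace_add subspace_diff) auto
    finally have u: "G' s e \<in> F" .
    then have Ae: "A s e = g' (G s) (G' s e)" using \<pi>(3) GF[OF s] by (simp add: A_def)
    show "A s e \<in> (\<lambda>X. X d) ` D (chart_inv d (\<phi> s))"
      using Ae u Dq[OF GF[OF s]] d\<phi>[OF s] by simp
    show "B (A s e) = e"
      using Ae \<Phi>'F[of "G s" "G' s e"] u GF[OF s] \<open>\<Phi>' (G s) (G' s e) = e\<close> by simp
  next
    fix V' assume V': "open V'" "V' \<subseteq> V"
    have "open (U' \<inter> \<Phi> -` V')"
      using hom V' U'(1) by (intro continuous_open_preimage) (auto simp: homeomorphism_def)
    then have op: "openin (mtop N) {x \<in> fst c. snd c x \<in> U' \<inter> \<Phi> -` V'}"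
      by (rule chart_preimage_open[OF Nm cN(1)])
    \<comment> \<open>Seen in the chart of the leaf, the image is the preimage of an open set, hence
      open in the leaf's own topology.\<close>
    have "(\<lambda>s. chart_inv d (\<phi> s)) ` (V' \<inter> F) = {x \<in> fst c. snd c x \<in> U' \<inter> \<Phi> -` V'}"
    proof (intro equalityI subsetI)
      fix x assume "x \<in> (\<lambda>s. chart_inv d (\<phi> s)) ` (V' \<inter> F)"
      then obtain s where s: "s \<in> V'" "s \<in> F" "x = chart_inv d (\<phi> s)" by auto
      then have sV: "s \<in> V \<inter> F" using V' by auto
      show "x \<in> {x \<in> fst c. snd c x \<in> U' \<inter> \<Phi> -` V'}"
        using s d\<phi>[OF sV] ccq[OF GF[OF sV]] GV[of s] sV by simp
    next
      fix x assume "x \<in> {x \<in> fst c. snd c x \<in> U' \<inter> \<Phi> -` V'}"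
      then have x: "x \<in> fst c" "snd c x \<in> U'" "\<Phi> (snd c x) \<in> V'" by auto
      have xF: "snd c x \<in> F" unfolding F_def by (rule chart_in_model[OF Nm cN(1) x(1)])
      have sF: "\<Phi> (snd c x) \<in> V' \<inter> F" using x \<Phi>F[OF xF] BF by simp
      then have "chart_inv d (\<phi> (\<Phi> (snd c x))) = x"
        using d\<phi>[of "\<Phi> (snd c x)"] V' GU(1)[OF x(2)] chart_inv_chart[OF Nm cN(1) x(1)] by auto
      then show "x \<in> (\<lambda>s. chart_inv d (\<phi> s)) ` (V' \<inter> F)" using sF by (metis imageI)
    qed
    then show "openin (mtop N) ((\<lambda>s. chart_inv d (\<phi> s)) ` (V' \<inter> F))" using op by simp
  qed (use P N p d F B V in auto)
qed

section \<open>Lipschitz sections lifting the vectors of a leaf model\<close>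

text \<open>Linear combinations \<open>M w\<close> of the given sections lift vectors of
  \<open>F\<close> under \<open>B\<close> exactly at \<open>x0\<close>. At other \<open>w\<close>
  the composition \<open>B \<circ> M w\<close> is close to the identity on \<open>F\<close>, and
  precomposing \<open>M w\<close> with an inverse makes the lift exact again. The values remain
  combinations of the \<open>Z b w\<close>, hence in \<open>\<Delta> w\<close>, which may have
  larger dimension than \<open>F\<close>.\<close>

lemma lipschitz_frame:
  fixes A0 B :: "'e::euclidean_space \<Rightarrow> 'e" and \<Delta> :: "'e \<Rightarrow> 'e set"
  assumes F: "subspace F" and B: "linear B" "range B \<subseteq> F"
    and A0: "linear A0" "\<And>e. e \<in> F \<Longrightarrow> B (A0 e) = e"
    and ext: "\<And>e. e \<in> F \<Longrightarrow> \<exists>Z r K. 0 < r \<and> Z x0 = A0 e \<and> K-lipschitz_on (ball x0 r \<inter> E) Z \<and>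
        (\<forall>w\<in>ball x0 r \<inter> E. w \<in> T \<and> Z w \<in> \<Delta> w)"
    and \<Delta>: "\<And>w. w \<in> T \<Longrightarrow> subspace (\<Delta> w)" and x0: "x0 \<in> E"
  obtains Y :: "'e \<Rightarrow> 'e \<Rightarrow> 'e" and r K :: real where "0 < r" "0 \<le> K"
    "\<And>w. w \<in> ball x0 r \<inter> E \<Longrightarrow> w \<in> T"
    "\<And>w e. w \<in> ball x0 r \<inter> E \<Longrightarrow> e \<in> F \<Longrightarrow> Y w e \<in> \<Delta> w"
    "\<And>w e. w \<in> ball x0 r \<inter> E \<Longrightarrow> e \<in> F \<Longrightarrow> B (Y w e) = e"
    "\<And>w e. w \<in> ball x0 r \<inter> E \<Longrightarrow> norm (Y w e) \<le> K * norm e"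
    "\<And>w w' e. w \<in> ball x0 r \<inter> E \<Longrightarrow> w' \<in> ball x0 r \<inter> E \<Longrightarrow>
       norm (Y w e - Y w' e) \<le> K * norm (w - w') * norm e"
proof -
  obtain \<rho> where \<rho>: "linear \<rho>" "range \<rho> \<subseteq> F" "\<And>x. x \<in> F \<Longrightarrow> \<rho> x = x"
    using subspace_projection[OF F] by metis
  have \<rho>F: "\<rho> u \<in> F" for u using \<rho>(2) by auto
  have BF: "B u \<in> F" for u using B(2) by auto
  have "\<forall>b. \<exists>Z r K. 0 < r \<and> Z x0 = A0 (\<rho> b) \<and> K-lipschitz_on (ball x0 r \<inter> E) Z \<and>
        (\<forall>w\<in>ball x0 r \<inter> E. w \<in> T \<and> Z w \<in> \<Delta> w)"
    using ext \<rho>F by blast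
  then obtain Z R k where R: "\<And>b. 0 < R b" and Zx0: "\<And>b. Z b x0 = A0 (\<rho> b)"
    and k: "\<And>b. (k b)-lipschitz_on (ball x0 (R b) \<inter> E) (Z b)"
    and Z: "\<And>b w. w \<in> ball x0 (R b) \<inter> E \<Longrightarrow> w \<in> T \<and> Z b w \<in> \<Delta> w"
    by metis
  \<comment> \<open>One radius per basis vector; the extra 1 bounds \<open>norm (w - x0)\<close> in
    the estimate \<open>Mb\<close>.\<close>
  define r1 where "r1 = Min (insert 1 (R ` Basis))"
  have r1: "0 < r1" "r1 \<le> 1" "\<And>b. b \<in> Basis \<Longrightarrow> r1 \<le> R b"
    unfolding r1_def using R by (auto intro: min.coboundedI2)
  define K1 where "K1 = (\<Sum>b\<in>Basis. k b)"
  have k0: "0 \<le> k b" for b using k lipschitz_on_nonneg by blast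
  have K1: "0 \<le> K1" unfolding K1_def by (intro sum_nonneg k0)
  define M where "M w u = (\<Sum>b\<in>Basis. (u \<bullet> b) *\<^sub>R Z b w)" for w u
  have linM: "linear (M w)" for w
    by (rule linearI) (simp_all add: M_def inner_add_left scaleR_left_distrib sum.distrib scaleR_right.sum)
  have M\<Delta>: "M w u \<in> \<Delta> w" if "w \<in> ball x0 r1 \<inter> E" for w u
  proof -
    have "w \<in> ball x0 (R b) \<inter> E" if "b \<in> Basis" for b
      using r1(3)[OF that] \<open>w \<in> ball x0 r1 \<inter> E\<close> by auto
    then have "w \<in> T" "\<And>b. b \<in> Basis \<Longrightarrow> Z b w \<in> \<Delta> w" using Z nonempty_Basis by blast+
    then show ?thesis unfolding M_def by (intro subspace_sum subspace_scale \<Delta>)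
  qed
  have Mlip: "norm (M w u - M w' u) \<le> K1 * norm (w - w') * norm u"
    if "w \<in> ball x0 r1 \<inter> E" "w' \<in> ball x0 r1 \<inter> E" for w w' u
  proof -
    have "norm (M w u - M w' u) = norm (\<Sum>b\<in>Basis. (u \<bullet> b) *\<^sub>R (Z b w - Z b w'))"
      by (simp add: M_def sum_subtractf scaleR_diff_right)
    also have "\<dots> \<le> (\<Sum>b\<in>Basis. norm u * (k b * norm (w - w')))"
    proof (rule sum_norm_le)
      fix b :: 'e assume b: "b \<in> Basis"
      have "norm (Z b w - Z b w') \<le> k b * norm (w - w')"
        using lipschitz_onD[OF k[of b], of w w'] that r1(3)[OF b] by (auto simp: dist_norm)
      then show "norm ((u \<bullet> b) *\<^sub>R (Z b w - Z b w')) \<le> norm u * (k b * norm (w - w'))"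
        using Basis_le_norm[OF b, of u] by (simp add: mult_mono)
    qed
    also have "\<dots> = K1 * norm (w - w') * norm u"
      by (simp add: K1_def sum_distrib_left sum_distrib_right mult_ac)
    finally show ?thesis .
  qed
  have M0: "M x0 u = A0 (\<rho> u)" for u
  proof -
    have "M x0 u = A0 (\<rho> (\<Sum>b\<in>Basis. (u \<bullet> b) *\<^sub>R b))"
      by (simp add: M_def Zx0 linear_sum[OF A0(1)] linear_sum[OF \<rho>(1)] linear_cmul[OF A0(1)] linear_cmul[OF \<rho>(1)])
    then show ?thesis by (simp add: euclidean_representation)
  qed
  obtain K0 where K0: "0 < K0" "\<And>u. norm (M x0 u) \<le> K0 * norm u"
    using linear_bounded_pos[OF linM] by metis
  obtain \<beta> where \<beta>: "0 < \<beta>" "\<And>u. norm (B u) \<le> \<beta> * norm u"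
    using linear_bounded_pos[OF B(1)] by metis
  define K2 where "K2 = K0 + K1"
  have K2: "0 \<le> K2" using K0 K1 by (simp add: K2_def)
  have Mb: "norm (M w u) \<le> K2 * norm u" if w: "w \<in> ball x0 r1 \<inter> E" for w u
  proof -
    have "norm (M w u - M x0 u) \<le> K1 * norm (w - x0) * norm u"
      using Mlip[OF w, of x0 u] x0 r1 by simp
    also have "\<dots> \<le> K1 * 1 * norm u"
      using w r1 K1 by (intro mult_mono) (auto simp: dist_norm norm_minus_commute)
    finally show ?thesis
      using K0(2)[of u] norm_triangle_sub[of "M w u" "M x0 u"] by (simp add: K2_def algebra_simps)
  qed
  \<comment> \<open>\<open>L w\<close> is \<open>B \<circ> M w\<close> on \<open>F\<close>, made invertible off \<open>F\<close>; it is the identity at \<open>x0\<close>.\<close>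
  define L where "L w u = B (M w u) + u - \<rho> u" for w u
  have linL: "linear (L w)" for w
    unfolding L_def
    by (intro linear_compose_sub linear_compose_add linear_compose[OF linM B(1), unfolded o_def] linear_ident \<rho>(1))
  have L0: "L x0 u = u" for u by (simp add: L_def M0 A0(2)[OF \<rho>F])
  have Llip: "norm (L w u - L w' u) \<le> \<beta> * K1 * norm (w - w') * norm u"
    if "w \<in> ball x0 r1 \<inter> E" "w' \<in> ball x0 r1 \<inter> E" for w w' u
  proof -
    have "norm (L w u - L w' u) = norm (B (M w u - M w' u))"
      by (simp add: L_def linear_diff[OF B(1)])
    also have "\<dots> \<le> \<beta> * (K1 * norm (w - w') * norm u)"
      using \<beta>(2)[of "M w u - M w' u"] Mlip[OF that, of u] \<beta>(1) by (meson mult_left_mono order_trans less_imp_le)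
    finally show ?thesis by (simp add: mult_ac)
  qed
  \<comment> \<open>Gives \<open>\<beta> * K1 * norm (w - x0) \<le> 1/2\<close>, the threshold of
    \<open>perturbed_identity\<close>; the added 1 keeps the denominator positive.\<close>
  define r where "r = min r1 (1 / (2 * (\<beta> * K1 + 1)))"
  have \<beta>K1: "0 \<le> \<beta> * K1" using \<beta> K1 by simp
  have r: "0 < r" using r1 \<beta>K1 by (simp add: r_def)
  have rr: "w \<in> ball x0 r1 \<inter> E" if "w \<in> ball x0 r \<inter> E" for w using that by (auto simp: r_def)
  have near: "norm (L w u - u) \<le> norm u / 2" if w: "w \<in> ball x0 r \<inter> E" for w u
  proof -
    have "norm (L w u - u) \<le> \<beta> * K1 * norm (w - x0) * norm u"
      using Llip[OF rr[OF w], of x0 u] x0 r1 L0 by simp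
    also have "\<dots> \<le> 1/2 * norm u"
    proof (intro mult_right_mono)
      have "\<beta> * K1 * norm (w - x0) \<le> (\<beta> * K1 + 1) * (1 / (2 * (\<beta> * K1 + 1)))"
        using w \<beta>K1 by (intro mult_mono) (auto simp: r_def dist_norm norm_minus_commute)
      also have "\<dots> = 1 / 2" using \<beta>K1 by (simp add: field_simps)
      finally show "\<beta> * K1 * norm (w - x0) \<le> 1 / 2" .
    qed simp
    finally show ?thesis by simp
  qed
  have bij: "bij (L w)" and invb: "norm (inv (L w) e) \<le> 2 * norm e"
    if "w \<in> ball x0 r \<inter> E" for w e
    using perturbed_identity[OF linL near[OF that]] by blast+
  have Linv: "L w (inv (L w) e) = e" if "w \<in> ball x0 r \<inter> E" for w e
    using bij[OF that] by (simp add: bij_is_surj surj_f_inv_f)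
  define Y where "Y w e = M w (inv (L w) e)" for w e
  \<comment> \<open>The first two summands are a Lipschitz constant, from varying the inverse of
    \<open>L w\<close> and from varying \<open>M w\<close>; the last one bounds the norm of
    \<open>Y\<close>.\<close>
  define K where "K = K2 * (4 * (\<beta> * K1)) + 2 * K1 + 2 * K2"
  have K: "0 \<le> K" using K2 K1 \<beta>K1 by (simp add: K_def)
  show thesis
  proof (rule that[OF r K])
    fix w assume w: "w \<in> ball x0 r \<inter> E"
    obtain b :: 'e where "b \<in> Basis" using nonempty_Basis by blast
    then show "w \<in> T" using Z[of w b] rr[OF w] r1(3) by fastforce
  next
    fix w e assume w: "w \<in> ball x0 r \<inter> E"
    show "Y w e \<in> \<Delta> w" unfolding Y_def by (rule M\<Delta>[OF rr[OF w]])
    have "norm (Y w e) \<le> K2 * (2 * norm e)"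
      unfolding Y_def using Mb[OF rr[OF w]] invb[OF w] K2 by (meson mult_left_mono order_trans)
    also have "\<dots> = (2 * K2) * norm e" by simp
    also have "\<dots> \<le> K * norm e"
      using K2 K1 \<beta>K1 by (intro mult_right_mono) (auto simp: K_def)
    finally show "norm (Y w e) \<le> K * norm e" .
  next
    fix w e assume w: "w \<in> ball x0 r \<inter> E" and e: "e \<in> F"
    define u where "u = inv (L w) e"
    have eq: "B (M w u) + u - \<rho> u = e" using Linv[OF w, of e] by (simp add: u_def L_def)
    \<comment> \<open>The solution lies in \<open>F\<close>, where \<open>\<rho>\<close> is the
      identity, so the correction \<open>u - \<rho> u\<close> disappears.\<close>
    then have "u = e - B (M w u) + \<rho> u" by (simp add: algebra_simps)
    also have "\<dots> \<in> F" using e BF \<rho>F F by (intro subspace_add subspace_diff) auto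
    finally have "\<rho> u = u" using \<rho>(3) by simp
    then show "B (Y w e) = e" using eq by (simp add: Y_def u_def)
  next
    fix w w' e assume w: "w \<in> ball x0 r \<inter> E" and w': "w' \<in> ball x0 r \<inter> E"
    define u where "u = inv (L w) e"
    define u' where "u' = inv (L w') e"
    have ub: "norm u' \<le> 2 * norm e" using invb[OF w'] by (simp add: u'_def)
    \<comment> \<open>Resolvent identity: \<open>L w u\<close> and \<open>L w' u'\<close> both equal
      \<open>e\<close>.\<close>
    have "L w (u - u') = L w' u' - L w u'"
      using Linv[OF w, of e] Linv[OF w', of e] by (simp add: linear_diff[OF linL] u_def u'_def)
    then have "u - u' = inv (L w) (L w' u' - L w u')"
      using bij[OF w] by (metis bij_inv_eq_iff)
    then have "norm (u - u') \<le> 2 * norm (L w' u' - L w u')" using invb[OF w] by simp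
    also have "\<dots> \<le> 2 * (\<beta> * K1 * norm (w - w') * norm u')"
      using Llip[OF rr[OF w'] rr[OF w], of u'] by (simp add: norm_minus_commute)
    also have "\<dots> \<le> 2 * (\<beta> * K1 * norm (w - w') * (2 * norm e))"
      using ub \<beta>K1 by (intro mult_left_mono) auto
    finally have du: "norm (u - u') \<le> 4 * (\<beta> * K1) * norm (w - w') * norm e" by (simp add: mult_ac)
    have "norm (Y w e - Y w' e) = norm (M w (u - u') + (M w u' - M w' u'))"
      by (simp add: Y_def u_def u'_def linear_diff[OF linM])
    also have "\<dots> \<le> norm (M w (u - u')) + norm (M w u' - M w' u')" by (rule norm_triangle_ineq)
    also have "\<dots> \<le> K2 * (4 * (\<beta> * K1) * norm (w - w') * norm e) + K1 * norm (w - w') * (2 * norm e)"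
    proof (rule add_mono)
      show "norm (M w (u - u')) \<le> K2 * (4 * (\<beta> * K1) * norm (w - w') * norm e)"
        using Mb[OF rr[OF w]] du K2 by (meson mult_left_mono order_trans)
      show "norm (M w u' - M w' u') \<le> K1 * norm (w - w') * (2 * norm e)"
        using Mlip[OF rr[OF w] rr[OF w'], of u'] ub K1 by (meson mult_left_mono mult_nonneg_nonneg norm_ge_zero order_trans)
    qed
    also have "\<dots> = (K2 * (4 * (\<beta> * K1)) + 2 * K1) * (norm (w - w') * norm e)"
      by (simp add: algebra_simps)
    also have "\<dots> \<le> K * (norm (w - w') * norm e)"
      using K2 by (intro mult_right_mono) (auto simp: K_def)
    finally show "norm (Y w e - Y w' e) \<le> K * norm (w - w') * norm e" by (simp add: mult.assoc)
  qed
qed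

text \<open>A vector in \<open>D p\<close> is a finite combination of values of sections on
  different domains, so the property is proved by span induction, where sums shrink the ball. For a
  generator the derivative of a C1 extension is bounded near \<open>snd d p\<close>, and convexity
  of the ball turns this into a Lipschitz constant.\<close>

lemma tangent_vector_lipschitz_extension:
  fixes P :: "('a, 'e::euclidean_space) manifold"
  assumes P: "smooth_manifold P" and D: "smooth_distribution P D"
    and d: "d \<in> charts_at P p" and X: "X \<in> D p"
  shows "\<exists>Z r K. 0 < r \<and> Z (snd d p) = X d \<and> K-lipschitz_on (ball (snd d p) r \<inter> model P) Z \<and>
        (\<forall>w\<in>ball (snd d p) r \<inter> model P. w \<in> snd d ` fst d \<and> Z w \<in> (\<lambda>X. X d) ` D (chart_inv d w))"
    (is "?Q X")
proof -
  let ?S = "{X p |U X. p \<in> U \<and> smooth_local_section P D U X}"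
  have dP: "d \<in> atlas P" "p \<in> fst d" using d by (auto simp: charts_at_def)
  have fd: "fst d \<subseteq> topspace (mtop P)" by (rule openin_subset[OF chart_homeomorphic(1)[OF P dP(1)]])
  have sub: "subspace (D (chart_inv d w))" if "w \<in> snd d ` fst d" for w
    using that fd D chart_inv_chart[OF P dP(1)] by (auto simp: smooth_distribution_def)
  have "X \<in> span ?S" using D dP fd X by (auto simp: smooth_distribution_def)
  then show "?Q X"
  proof (rule span_induct)
    fix X' assume "X' \<in> ?S"
    then obtain U X where U: "p \<in> U" and X': "X' = X p" and sec: "smooth_local_section P D U X" by auto
    have opU: "openin (mtop P) U" and XD: "\<And>y. y \<in> U \<Longrightarrow> X y \<in> D y"
      and sm: "smooth_on (snd d ` (fst d \<inter> U)) (\<lambda>w. X (chart_inv d w) d)"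
      using sec dP by (auto simp: smooth_local_section_def smooth_vector_field_on_def)
    have op: "openin (top_of_set (model P)) (snd d ` (fst d \<inter> U))"
      by (rule chart_image_open[OF P dP(1)]) (use opU chart_homeomorphic(1)[OF P dP(1)] in auto)
    obtain W g and g' :: "'e \<Rightarrow> 'e \<Rightarrow>\<^sub>L 'e" where W: "open W" "snd d p \<in> W"
      and sub: "model P \<inter> W \<subseteq> snd d ` (fst d \<inter> U)"
      and gq: "\<And>w. w \<in> model P \<inter> W \<Longrightarrow> g w = X (chart_inv d w) d"
      and g': "\<And>w. w \<in> W \<Longrightarrow> (g has_derivative blinfun_apply (g' w)) (at w)"
      and cg': "continuous_on W g'"
      using smooth_on_C1_extension[OF sm op, of "snd d p"] U dP by blast
    have "open (W \<inter> g' -` ball (g' (snd d p)) 1)"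
      by (rule continuous_open_preimage[OF cg' W(1) open_ball])
    moreover have "snd d p \<in> W \<inter> g' -` ball (g' (snd d p)) 1" using W(2) by simp
    ultimately obtain r where r: "0 < r" "ball (snd d p) r \<subseteq> W \<inter> g' -` ball (g' (snd d p)) 1"
      by (rule openE)
    have "(norm (g' (snd d p)) + 1)-lipschitz_on (ball (snd d p) r) g"
    proof (rule lipschitz_onI)
      fix w w' assume ww: "w \<in> ball (snd d p) r" "w' \<in> ball (snd d p) r"
      have "norm (g w - g w') \<le> (norm (g' (snd d p)) + 1) * norm (w - w')"
      proof (rule differentiable_bound[OF convex_ball _ _ ww])
        fix v assume v: "v \<in> ball (snd d p) r"
        show "(g has_derivative blinfun_apply (g' v)) (at v within ball (snd d p) r)"
          using v r g' by (blast intro: has_derivative_at_withinI)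
        have "v \<in> W \<inter> g' -` ball (g' (snd d p)) 1" using v r by blast
        then have "norm (g' v) \<le> norm (g' (snd d p)) + 1"
          using norm_triangle_sub[of "g' v" "g' (snd d p)"] by (auto simp: dist_norm norm_minus_commute)
        then show "onorm (blinfun_apply (g' v)) \<le> norm (g' (snd d p)) + 1"
          by (simp add: norm_blinfun.rep_eq)
      qed
      then show "dist (g w) (g w') \<le> (norm (g' (snd d p)) + 1) * dist w w'" by (simp add: dist_norm)
    qed simp
    then have lip: "(norm (g' (snd d p)) + 1)-lipschitz_on (ball (snd d p) r \<inter> model P) g"
      by (rule lipschitz_on_subset) simp
    show "?Q X'"
    proof (rule exI[of _ g], rule exI[of _ r], rule exI[of _ "norm (g' (snd d p)) + 1"], intro conjI ballI r(1) lip)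
      show "g (snd d p) = X' d"
        using gq[of "snd d p"] W(2) chart_in_model[OF P dP] chart_inv_chart[OF P dP] X' by simp
    next
      fix w assume "w \<in> ball (snd d p) r \<inter> model P"
      then have w: "w \<in> model P \<inter> W" using r by blast
      then obtain y where y: "y \<in> fst d" "y \<in> U" "w = snd d y" using sub by auto
      then show "w \<in> snd d ` fst d" by simp
      show "g w \<in> (\<lambda>X. X d) ` D (chart_inv d w)"
        using gq[OF w] y XD chart_inv_chart[OF P dP(1) y(1)] by simp
    qed
  next
    show "subspace {X. ?Q X}"
      unfolding subspace_def mem_Collect_eq
    proof (intro conjI ballI allI)
      obtain V where V: "open V" "snd d ` fst d = model P \<inter> V"
        using chart_homeomorphic(2)[OF P dP(1)] by (metis openin_open)
      then obtain r where r: "0 < r" "ball (snd d p) r \<subseteq> V"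
        using dP open_contains_ball[of V] by blast
      have img: "w \<in> snd d ` fst d" if "w \<in> ball (snd d p) r \<inter> model P" for w using that V r by blast
      have "0 \<in> (\<lambda>X. X d) ` D (chart_inv d w)" if "w \<in> ball (snd d p) r \<inter> model P" for w
        using subspace_0[OF sub[OF img[OF that]]] by (auto intro!: rev_image_eqI)
      note zD = this
      show "?Q 0"
        by (rule exI[of _ "\<lambda>_. 0"], rule exI[of _ r], rule exI[of _ 0])
          (use r(1) img zD in \<open>auto intro: lipschitz_on_constant\<close>)
    next
      fix X1 X2 assume "X1 \<in> {X. ?Q X}" "X2 \<in> {X. ?Q X}"
      then obtain Z1 r1 K1 Z2 r2 K2 where r: "0 < r1" "0 < r2" and eq: "Z1 (snd d p) = X1 d" "Z2 (snd d p) = X2 d"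
        and lip: "K1-lipschitz_on (ball (snd d p) r1 \<inter> model P) Z1" "K2-lipschitz_on (ball (snd d p) r2 \<inter> model P) Z2"
        and Z1: "\<And>w. w\<in>ball (snd d p) r1 \<inter> model P \<Longrightarrow> w \<in> snd d ` fst d \<and> Z1 w \<in> (\<lambda>X. X d) ` D (chart_inv d w)"
        and Z2: "\<And>w. w\<in>ball (snd d p) r2 \<inter> model P \<Longrightarrow> w \<in> snd d ` fst d \<and> Z2 w \<in> (\<lambda>X. X d) ` D (chart_inv d w)"
        unfolding mem_Collect_eq by blast
      show "?Q (X1 + X2)"
      proof (rule exI[of _ "\<lambda>w. Z1 w + Z2 w"], rule exI[of _ "min r1 r2"], rule exI[of _ "K1 + K2"], intro conjI ballI)
        show "(K1 + K2)-lipschitz_on (ball (snd d p) (min r1 r2) \<inter> model P) (\<lambda>w. Z1 w + Z2 w)"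
          by (intro lipschitz_on_add lipschitz_on_subset[OF lip(1)] lipschitz_on_subset[OF lip(2)]) auto
      next
        fix w assume "w \<in> ball (snd d p) (min r1 r2) \<inter> model P"
        then have w: "w \<in> ball (snd d p) r1 \<inter> model P" "w \<in> ball (snd d p) r2 \<inter> model P" by auto
        show img: "w \<in> snd d ` fst d" using Z1 w by blast
        obtain V1 V2 where V: "V1 \<in> D (chart_inv d w)" "Z1 w = V1 d" "V2 \<in> D (chart_inv d w)" "Z2 w = V2 d"
          using Z1[OF w(1)] Z2[OF w(2)] by blast
        then have "V1 + V2 \<in> D (chart_inv d w)" using sub[OF img] subspace_add by blast
        then show "Z1 w + Z2 w \<in> (\<lambda>X. X d) ` D (chart_inv d w)"
          using V by (auto intro: rev_image_eqI)
      qed (use r eq in auto)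
    next
      fix a X1 assume "X1 \<in> {X. ?Q X}"
      then obtain Z1 r1 K1 where r: "0 < r1" and eq: "Z1 (snd d p) = X1 d"
        and lip: "K1-lipschitz_on (ball (snd d p) r1 \<inter> model P) Z1"
        and Z1: "\<And>w. w\<in>ball (snd d p) r1 \<inter> model P \<Longrightarrow> w \<in> snd d ` fst d \<and> Z1 w \<in> (\<lambda>X. X d) ` D (chart_inv d w)"
        unfolding mem_Collect_eq by blast
      show "?Q (a *\<^sub>R X1)"
      proof (rule exI[of _ "\<lambda>w. a *\<^sub>R Z1 w"], rule exI[of _ r1], rule exI[of _ "\<bar>a\<bar> * K1"], intro conjI ballI r)
        show "(\<bar>a\<bar> * K1)-lipschitz_on (ball (snd d p) r1 \<inter> model P) (\<lambda>w. a *\<^sub>R Z1 w)"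
          by (rule lipschitz_on_cmult[OF lip])
      next
        fix w assume w: "w \<in> ball (snd d p) r1 \<inter> model P"
        show img: "w \<in> snd d ` fst d" using Z1 w by blast
        obtain V1 where V: "V1 \<in> D (chart_inv d w)" "Z1 w = V1 d"
          using Z1[OF w] by blast
        then have "a *\<^sub>R V1 \<in> D (chart_inv d w)" using sub[OF img] subspace_scale by blast
        then show "a *\<^sub>R Z1 w \<in> (\<lambda>X. X d) ` D (chart_inv d w)"
          using V by (auto simp: scaleR_fun_def intro: rev_image_eqI)
      qed (use eq in \<open>auto simp: scaleR_fun_def\<close>)
    qed
  qed
qed

section \<open>Flows and regular leaves\<close>

lemma leaf_projI:
  assumes "integrable_distribution P D" "L \<in> leaves P D" "x \<in> L"
  shows "leaf_proj P D x = L"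
  unfolding leaf_proj_def
proof (rule the_equality)
  fix L' assume "L' \<in> leaves P D \<and> x \<in> L'"
  then show "L' = L"
    using assms unfolding integrable_distribution_def partition_on_def disjoint_def by blast
qed (use assms in simp)

lemma leaf_proj_leaf:
  assumes "integrable_distribution P D" "x \<in> topspace (mtop P)"
  shows "leaf_proj P D x \<in> leaves P D" "x \<in> leaf_proj P D x"
proof -
  obtain L where "L \<in> leaves P D" "x \<in> L"
    using assms unfolding integrable_distribution_def partition_on_def by blast
  then show "leaf_proj P D x \<in> leaves P D" "x \<in> leaf_proj P D x"
    using leaf_projI[OF assms(1)] by auto
qed

lemma leaf_subset:
  assumes "integrable_distribution P D" "L \<in> leaves P D"
  shows "L \<subseteq> topspace (mtop P)"
  using assms unfolding integrable_distribution_def partition_on_def by blast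

lemma leaf_manifold:
  assumes "L \<in> leaves P D"
  obtains N where "connected_integral_manifold P D N" "topspace (mtop N) = L"
  using assms unfolding leaves_def by blast

lemma subspace_coordinate_image:
  assumes "subspace (V :: ('a \<Rightarrow> 'b::real_vector) set)"
  shows "subspace ((\<lambda>X. X d) ` V)"
  by (rule linear_subspace_image[OF _ assms], rule linearI) (simp_all add: scaleR_fun_def)

context leaf_parametrisation
begin

lemma d_atlas: "d \<in> atlas P" and p_in_d: "p \<in> fst d"
  using d by (auto simp: charts_at_def)

lemma B_in_F: "B u \<in> F"
  using range_B by auto

lemma base: "B (snd d p) \<in> W \<inter> F"
  using base_W B_in_F by simp

lemma chart_inv_\<phi>_base: "chart_inv d (\<phi> (B (snd d p))) = p"
  using \<phi>_base chart_inv_chart[OF P d_atlas p_in_d] by simp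

lemma linear_A: "s \<in> W \<Longrightarrow> linear (A s)"
  using \<phi>_deriv has_derivative_linear by blast

lemma continuous_on_\<phi>: "continuous_on W \<phi>"
  by (meson continuous_at_imp_continuous_on \<phi>_deriv has_derivative_continuous)

text \<open>At the base point \<open>B\<close> and \<open>A\<close> are mutually inverse between the
  coordinates of \<open>D p\<close> and \<open>F\<close>.\<close>

lemma mdim_eq: "mdim N = dim ((\<lambda>X. X d) ` D p)"
proof -
  let ?s0 = "B (snd d p)"
  note facts = A_in_D[OF base] B_A[OF base] A_B[OF base]
  have "F \<subseteq> B ` ((\<lambda>X. X d) ` D p)"
  proof
    fix e assume e: "e \<in> F"
    show "e \<in> B ` ((\<lambda>X. X d) ` D p)"
      using facts(1)[OF e] facts(2)[OF e] by (metis chart_inv_\<phi>_base image_eqI)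
  qed
  then have "dim F \<le> dim (B ` ((\<lambda>X. X d) ` D p))" by (rule dim_subset)
  also have "\<dots> \<le> dim ((\<lambda>X. X d) ` D p)" by (rule dim_image_le[OF B])
  finally have le: "dim F \<le> dim ((\<lambda>X. X d) ` D p)" .
  have "(\<lambda>X. X d) ` D p \<subseteq> A ?s0 ` F"
  proof (rule image_subsetI)
    fix X assume "X \<in> D p"
    then have "A ?s0 (B (X d)) = X d" using facts(3)[of X] chart_inv_\<phi>_base by simp
    then show "X d \<in> A ?s0 ` F" using B_in_F by (metis image_eqI)
  qed
  then have "dim ((\<lambda>X. X d) ` D p) \<le> dim (A ?s0 ` F)" by (rule dim_subset)
  also have "\<dots> \<le> dim F" by (rule dim_image_le[OF linear_A[OF base_W]])
  finally show ?thesis using le dim_F by simp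
qed

text \<open>At \<open>p\<close> itself \<open>A\<close> lifts vectors of \<open>F\<close> under
  \<open>B\<close> into \<open>D\<close>; these values extend to Lipschitz sections, which
  \<open>lipschitz_frame\<close> normalises. The domain is a neighbourhood in \<open>P\<close>, so
  the lifts also exist on nearby leaves, possibly of other dimension.\<close>

lemma lipschitz_lift:
  assumes D: "smooth_distribution P D"
  obtains Y :: "'e \<Rightarrow> 'e \<Rightarrow> 'e" and r K :: real where "0 < r" "0 \<le> K"
    "\<And>w. w \<in> ball (snd d p) r \<inter> model P \<Longrightarrow> w \<in> snd d ` fst d"
    "\<And>w e. w \<in> ball (snd d p) r \<inter> model P \<Longrightarrow> e \<in> F \<Longrightarrow> Y w e \<in> (\<lambda>X. X d) ` D (chart_inv d w)"
    "\<And>w e. w \<in> ball (snd d p) r \<inter> model P \<Longrightarrow> e \<in> F \<Longrightarrow> B (Y w e) = e"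
    "\<And>w e. w \<in> ball (snd d p) r \<inter> model P \<Longrightarrow> norm (Y w e) \<le> K * norm e"
    "\<And>w w' e. w \<in> ball (snd d p) r \<inter> model P \<Longrightarrow> w' \<in> ball (snd d p) r \<inter> model P \<Longrightarrow>
       norm (Y w e - Y w' e) \<le> K * norm (w - w') * norm e"
proof -
  have fd: "fst d \<subseteq> topspace (mtop P)" by (rule openin_subset[OF chart_homeomorphic(1)[OF P d_atlas]])
  have sub: "subspace ((\<lambda>X. X d) ` D (chart_inv d w))" if "w \<in> snd d ` fst d" for w
  proof (rule subspace_coordinate_image)
    have "chart_inv d w \<in> topspace (mtop P)" using that fd chart_inv_chart[OF P d_atlas] by auto
    then show "subspace (D (chart_inv d w))" using D unfolding smooth_distribution_def by blast
  qed
  have ext: "\<exists>Z r K. 0 < r \<and> Z (snd d p) = A (B (snd d p)) e \<and> K-lipschitz_on (ball (snd d p) r \<inter> model P) Z \<and>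
        (\<forall>w\<in>ball (snd d p) r \<inter> model P. w \<in> snd d ` fst d \<and> Z w \<in> (\<lambda>X. X d) ` D (chart_inv d w))"
    if e: "e \<in> F" for e
  proof -
    obtain X where X: "X \<in> D p" "A (B (snd d p)) e = X d"
      using A_in_D[OF base e] unfolding chart_inv_\<phi>_base by blast
    show ?thesis unfolding X(2) by (rule tangent_vector_lipschitz_extension[OF P D d X(1)])
  qed
  show thesis
  proof (rule lipschitz_frame[OF F B range_B linear_A[OF base_W] B_A[OF base] ext sub chart_in_model[OF P d_atlas p_in_d]])
    fix Y :: "'e \<Rightarrow> 'e \<Rightarrow> 'e" and r K :: real
    assume "0 < r" "0 \<le> K"
      "\<And>w. w \<in> ball (snd d p) r \<inter> model P \<Longrightarrow> w \<in> snd d ` fst d"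
      "\<And>w e. w \<in> ball (snd d p) r \<inter> model P \<Longrightarrow> e \<in> F \<Longrightarrow> Y w e \<in> (\<lambda>X. X d) ` D (chart_inv d w)"
      "\<And>w e. w \<in> ball (snd d p) r \<inter> model P \<Longrightarrow> e \<in> F \<Longrightarrow> B (Y w e) = e"
      "\<And>w e. w \<in> ball (snd d p) r \<inter> model P \<Longrightarrow> norm (Y w e) \<le> K * norm e"
      "\<And>w w' e. w \<in> ball (snd d p) r \<inter> model P \<Longrightarrow> w' \<in> ball (snd d p) r \<inter> model P \<Longrightarrow>
         norm (Y w e - Y w' e) \<le> K * norm (w - w') * norm e"
    then show thesis by (rule that)
  qed
qed

text \<open>The lifts \<open>Y\<close> show that \<open>B\<close> still maps \<open>D\<close> onto
  \<open>F\<close> at nearby points, so the rank cannot drop below \<open>dim F\<close>.\<close>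

lemma rank_lower_semicontinuous:
  assumes D: "smooth_distribution P D"
  obtains U where "openin (mtop P) U" "p \<in> U" "U \<subseteq> fst d"
    "\<And>x. x \<in> U \<Longrightarrow> dim ((\<lambda>X. X d) ` D p) \<le> dim ((\<lambda>X. X d) ` D x)"
proof (rule lipschitz_lift[OF D])
  fix Y :: "'e \<Rightarrow> 'e \<Rightarrow> 'e" and r :: real
  assume r: "0 < r"
    and YD: "\<And>w e. w \<in> ball (snd d p) r \<inter> model P \<Longrightarrow> e \<in> F \<Longrightarrow> Y w e \<in> (\<lambda>X. X d) ` D (chart_inv d w)"
    and BY: "\<And>w e. w \<in> ball (snd d p) r \<inter> model P \<Longrightarrow> e \<in> F \<Longrightarrow> B (Y w e) = e"
  show thesis
  proof (rule that)
    show "openin (mtop P) {x \<in> fst d. snd d x \<in> ball (snd d p) r}"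
      by (rule chart_preimage_open[OF P d_atlas open_ball])
    show "p \<in> {x \<in> fst d. snd d x \<in> ball (snd d p) r}" using p_in_d r by simp
    show "{x \<in> fst d. snd d x \<in> ball (snd d p) r} \<subseteq> fst d" by blast
    fix x assume "x \<in> {x \<in> fst d. snd d x \<in> ball (snd d p) r}"
    then have x: "x \<in> fst d" "snd d x \<in> ball (snd d p) r \<inter> model P"
      using chart_in_model[OF P d_atlas] by auto
    have "F \<subseteq> B ` ((\<lambda>X. X d) ` D x)"
    proof
      fix e assume e: "e \<in> F"
      show "e \<in> B ` ((\<lambda>X. X d) ` D x)"
        using YD[OF x(2) e] BY[OF x(2) e] chart_inv_chart[OF P d_atlas x(1)] by (metis image_eqI)
    qed
    then have "dim F \<le> dim (B ` ((\<lambda>X. X d) ` D x))" by (rule dim_subset)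
    also have "\<dots> \<le> dim ((\<lambda>X. X d) ` D x)" by (rule dim_image_le[OF B])
    finally show "dim ((\<lambda>X. X d) ` D p) \<le> dim ((\<lambda>X. X d) ` D x)"
      using mdim_eq dim_F by simp
  qed
qed

end

lemma integral_manifold_dim:
  fixes P :: "('a, 'e::euclidean_space) manifold"
  assumes P: "smooth_manifold P" and N: "connected_integral_manifold P D N"
    and p: "p \<in> topspace (mtop N)" and d: "d \<in> charts_at P p"
  shows "mdim N = dim ((\<lambda>X. X d) ` D p)"
proof (rule leaf_parametrisation_exists[OF P N p d])
  fix F B \<phi> W A a assume "leaf_parametrisation P D N p d F B \<phi> W A a"
  then show ?thesis by (rule leaf_parametrisation.mdim_eq)
qed

text \<open>Every integral manifold carrying \<open>L\<close> has the rank of \<open>D\<close> as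
  its dimension, so the definite description in \<open>leaf_dim\<close> is well defined and can be
  evaluated at any point of the leaf.\<close>

lemma leaf_dim_eq:
  fixes P :: "('a, 'e::euclidean_space) manifold"
  assumes P: "smooth_manifold P" and L: "L \<in> leaves P D" "x \<in> L" and d: "d \<in> charts_at P x"
  shows "leaf_dim P D L = dim ((\<lambda>X. X d) ` D x)"
  unfolding leaf_dim_def
proof (rule the_equality)
  obtain N where "connected_integral_manifold P D N" "topspace (mtop N) = L" using leaf_manifold[OF L(1)] .
  then show "\<exists>N. connected_integral_manifold P D N \<and> topspace (mtop N) = L \<and> mdim N = dim ((\<lambda>X. X d) ` D x)"
    using integral_manifold_dim[OF P _ _ d] L(2) by blast
qed (use integral_manifold_dim[OF P _ _ d] L(2) in blast)

section \<open>Integral curves stay in leaves\<close>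

text \<open>Near each time \<open>t0\<close> the curve is compared with its shadow
  \<open>\<phi> (B (\<gamma> t))\<close>, which lies in the leaf through \<open>\<gamma> t0\<close>
  by construction. The two coincide, so the leaf is locally constant in time, and the unit interval
  is connected.\<close>

lemma integral_curve_in_leaf:
  fixes P :: "('a, 'e::euclidean_space) manifold" and \<gamma> :: "real \<Rightarrow> 'e"
  assumes P: "smooth_manifold P" and int: "integrable_distribution P D" and d: "d \<in> atlas P"
    and img: "\<And>w. w \<in> ball x0 r \<inter> model P \<Longrightarrow> w \<in> snd d ` fst d"
    and lip: "\<And>w w'. w \<in> ball x0 r \<inter> model P \<Longrightarrow> w' \<in> ball x0 r \<inter> model P \<Longrightarrow>
       norm (Z w - Z w') \<le> K * norm (w - w')"
    and ZD: "\<And>w. w \<in> ball x0 r \<inter> model P \<Longrightarrow> Z w \<in> (\<lambda>X. X d) ` D (chart_inv d w)"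
    and \<gamma>: "\<And>t. t \<in> {0..1} \<Longrightarrow> \<gamma> t \<in> ball x0 r \<inter> model P"
    and d\<gamma>: "\<And>t. t \<in> {0..1} \<Longrightarrow> (\<gamma> has_vector_derivative Z (\<gamma> t)) (at t within {0..1})"
  shows "leaf_proj P D (chart_inv d (\<gamma> 0)) = leaf_proj P D (chart_inv d (\<gamma> 1))"
proof (rule connected_local_const[of "{0..1::real}"])
  show "\<forall>t0\<in>{0..1}. \<forall>\<^sub>F t in at t0 within {0..1}.
      leaf_proj P D (chart_inv d (\<gamma> t0)) = leaf_proj P D (chart_inv d (\<gamma> t))"
  proof
    fix t0 :: real assume t0: "t0 \<in> {0..1}"
    define p where "p = chart_inv d (\<gamma> t0)"
    obtain p' where p': "p' \<in> fst d" "\<gamma> t0 = snd d p'" using img[OF \<gamma>[OF t0]] by blast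
    then have pd: "p \<in> fst d" and sp: "snd d p = \<gamma> t0"
      using chart_inv_chart[OF P d] by (auto simp: p_def)
    have dp: "d \<in> charts_at P p" using d pd by (simp add: charts_at_def)
    have pt: "p \<in> topspace (mtop P)" using openin_subset[OF chart_homeomorphic(1)[OF P d]] pd by auto
    define L where "L = leaf_proj P D p"
    have L: "L \<in> leaves P D" "p \<in> L" using leaf_proj_leaf[OF int pt] by (auto simp: L_def)
    obtain N where N: "connected_integral_manifold P D N" and topN: "topspace (mtop N) = L"
      using leaf_manifold[OF L(1)] .
    have pN: "p \<in> topspace (mtop N)" using L topN by simp
    obtain F :: "'e set" and B \<phi> :: "'e \<Rightarrow> 'e" and W A a where "leaf_parametrisation P D N p d F B \<phi> W A a"
      by (rule leaf_parametrisation_exists[OF P N pN dp])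
    then interpret lp: leaf_parametrisation P D N p d F B \<phi> W A a .
    \<comment> \<open>The shadow has to stay in the ball, because the Lipschitz bound for
      \<open>Z\<close> is used there too.\<close>
    have op: "open (W \<inter> \<phi> -` ball x0 r)"
      using continuous_open_preimage[OF lp.continuous_on_\<phi> lp.W] open_ball by blast
    have dB\<gamma>: "((\<lambda>t. B (\<gamma> t)) has_vector_derivative B (Z (\<gamma> t))) (at t within {0..1})" if "t \<in> {0..1}" for t
      using bounded_linear.has_vector_derivative[OF _ d\<gamma>[OF that]] lp.B by (simp add: linear_conv_bounded_linear)
    then have "continuous (at t0 within {0..1}) (\<lambda>t. B (\<gamma> t))"
      using t0 has_vector_derivative_continuous by blast
    moreover have "B (\<gamma> t0) \<in> W \<inter> \<phi> -` ball x0 r"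
      using lp.base_W lp.\<phi>_base \<gamma>[OF t0] sp by simp
    ultimately have "\<forall>\<^sub>F t in at t0 within {0..1}. B (\<gamma> t) \<in> W \<inter> \<phi> -` ball x0 r"
      unfolding continuous_within by (rule topological_tendstoD[OF _ op])
    then obtain \<epsilon> where \<epsilon>: "0 < \<epsilon>" and "\<And>t. t \<in> {0..1} \<Longrightarrow> t \<noteq> t0 \<Longrightarrow> dist t t0 < \<epsilon> \<Longrightarrow> B (\<gamma> t) \<in> W \<inter> \<phi> -` ball x0 r"
      unfolding eventually_at by blast
    then have near: "B (\<gamma> t) \<in> W" "\<phi> (B (\<gamma> t)) \<in> ball x0 r" if "t \<in> {0..1}" "dist t t0 < \<epsilon>" for t
      using that \<open>B (\<gamma> t0) \<in> W \<inter> \<phi> -` ball x0 r\<close> by (metis IntD1 IntD2 vimageE)+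
    \<comment> \<open>A closed interval of radius \<open>\<epsilon> / 2\<close> lies in the region
      just found; it is cut to the unit interval, where \<open>\<gamma>\<close> is
      controlled.\<close>
    define J1 where "J1 = max 0 (t0 - \<epsilon> / 2)"
    define J2 where "J2 = min 1 (t0 + \<epsilon> / 2)"
    have J: "{J1..J2} \<subseteq> {0..1}" "t0 \<in> {J1..J2}" using t0 \<epsilon> by (auto simp: J1_def J2_def)
    have Jd: "dist t t0 < \<epsilon>" if "t \<in> {J1..J2}" for t
      using that \<epsilon> by (auto simp: J1_def J2_def dist_real_def)
    obtain \<beta> where \<beta>: "0 < \<beta>" "\<And>u. norm (B u) \<le> \<beta> * norm u"
      using linear_bounded_pos[OF lp.B] by metis
    \<comment> \<open>\<open>\<delta>\<close> satisfies \<open>norm \<delta>' \<le> const * norm \<delta>\<close> because \<open>A \<circ> B\<close> fixes \<open>Z\<close> at points of the leaf.\<close>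
    define \<delta> where "\<delta> t = \<gamma> t - \<phi> (B (\<gamma> t))" for t
    define \<delta>' where "\<delta>' t = Z (\<gamma> t) - A (B (\<gamma> t)) (B (Z (\<gamma> t)))" for t
    have zero: "\<delta> t = 0" if t: "t \<in> {J1..J2}" for t
    proof (rule vanishing_of_linear_growth[OF _ _ J(2) _ t])
      fix t assume t: "t \<in> {J1..J2}"
      then have t01: "t \<in> {0..1}" using J by blast
      note nt = near[OF t01 Jd[OF t]]
      have sWF: "B (\<gamma> t) \<in> W \<inter> F" using nt lp.B_in_F by simp
      have "((\<lambda>t. \<phi> (B (\<gamma> t))) has_vector_derivative A (B (\<gamma> t)) (B (Z (\<gamma> t)))) (at t within {0..1})"
        using vector_derivative_diff_chain_within[OF dB\<gamma>[OF t01], of \<phi> "A (B (\<gamma> t))"] lp.\<phi>_deriv nt(1)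
        by (auto simp: o_def intro: has_derivative_at_withinI)
      then have "(\<delta> has_vector_derivative \<delta>' t) (at t within {0..1})"
        unfolding \<delta>_def[abs_def] \<delta>'_def by (intro has_vector_derivative_diff d\<gamma>[OF t01])
      then show "(\<delta> has_vector_derivative \<delta>' t) (at t within {J1..J2})"
        by (rule has_vector_derivative_within_subset[OF _ J(1)])
      define q where "q = \<phi> (B (\<gamma> t))"
      have q: "q \<in> ball x0 r \<inter> model P"
        using nt(2) lp.chart_\<phi>[OF sWF] lp.\<phi>_in_leaf[OF sWF] chart_in_model[OF P d] by (metis IntD2 IntI q_def)
      have Zq: "A (B (\<gamma> t)) (B (Z q)) = Z q"
        using ZD[OF q] lp.A_B[OF sWF] by (auto simp: q_def)
      have lA: "linear (A (B (\<gamma> t)))" using lp.linear_A nt(1) by blast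
      have dZ: "norm (Z (\<gamma> t) - Z q) \<le> K * norm (\<delta> t)"
        using lip[OF \<gamma>[OF t01] q] by (simp add: \<delta>_def q_def)
      \<comment> \<open>Inserting \<open>Zq\<close> leaves only a difference of values of
        \<open>Z\<close>, to which the Lipschitz bound applies.\<close>
      have "\<delta>' t = (Z (\<gamma> t) - Z q) - A (B (\<gamma> t)) (B (Z (\<gamma> t) - Z q))"
        by (simp add: \<delta>'_def linear_diff[OF lp.B] linear_diff[OF lA] Zq)
      also have "norm \<dots> \<le> norm (Z (\<gamma> t) - Z q) + norm (A (B (\<gamma> t)) (B (Z (\<gamma> t) - Z q)))"
        by (rule norm_triangle_ineq4)
      also have "norm (A (B (\<gamma> t)) (B (Z (\<gamma> t) - Z q))) \<le> \<bar>a\<bar> * (\<beta> * norm (Z (\<gamma> t) - Z q))"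
        by (rule order_trans[OF lp.A_bound[OF nt(1)]]) (intro mult_mono \<beta>(2) abs_ge_self; simp)
      also have "norm (Z (\<gamma> t) - Z q) + \<bar>a\<bar> * (\<beta> * norm (Z (\<gamma> t) - Z q)) = (1 + \<bar>a\<bar> * \<beta>) * norm (Z (\<gamma> t) - Z q)"
        by (simp add: algebra_simps)
      also have "\<dots> \<le> (1 + \<bar>a\<bar> * \<beta>) * (K * norm (\<delta> t))"
        using dZ \<beta>(1) by (intro mult_left_mono) auto
      finally show "norm (\<delta>' t) \<le> ((1 + \<bar>a\<bar> * \<beta>) * K) * norm (\<delta> t)" by (simp add: mult.assoc)
    next
      show "\<delta> t0 = 0" using lp.\<phi>_base sp by (simp add: \<delta>_def)
    qed
    have "leaf_proj P D (chart_inv d (\<gamma> t0)) = leaf_proj P D (chart_inv d (\<gamma> t))" if t: "t \<in> {J1..J2}" for t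
    proof -
      have "B (\<gamma> t) \<in> W \<inter> F" using near(1)[of t] J(1) Jd[OF t] t lp.B_in_F by blast
      then have "chart_inv d (\<phi> (B (\<gamma> t))) \<in> L" using lp.\<phi>_in_leaf topN by blast
      moreover have "\<phi> (B (\<gamma> t)) = \<gamma> t"
        using zero[OF t] unfolding \<delta>_def right_minus_eq by (rule sym)
      ultimately have "chart_inv d (\<gamma> t) \<in> L" by (simp only:)
      then show ?thesis using leaf_projI[OF int L(1)] by (simp add: L_def p_def)
    qed
    moreover have "t \<in> {J1..J2}" if "t \<in> {0..1}" "dist t t0 < \<epsilon> / 2" for t
      using that unfolding J1_def J2_def dist_real_def atLeastAtMost_iff by linarith
    ultimately show "\<forall>\<^sub>F t in at t0 within {0..1}.
        leaf_proj P D (chart_inv d (\<gamma> t0)) = leaf_proj P D (chart_inv d (\<gamma> t))"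
      unfolding eventually_at using half_gt_zero[OF \<epsilon>] by blast
  qed
qed auto

section \<open>Regular points and their leaves\<close>

lemma openin_regular_points: "openin (mtop P) {x \<in> topspace (mtop P). regular_point P D x}"
proof (subst openin_subopen, intro ballI)
  fix x assume "x \<in> {x \<in> topspace (mtop P). regular_point P D x}"
  then obtain U k where U: "openin (mtop P) U" "x \<in> U" "\<forall>L\<in>leaves P D. L \<inter> U \<noteq> {} \<longrightarrow> leaf_dim P D L = k"
    unfolding regular_point_def by blast
  then have "U \<subseteq> {x \<in> topspace (mtop P). regular_point P D x}"
    using openin_subset[OF U(1)] unfolding regular_point_def by blast
  then show "\<exists>T. openin (mtop P) T \<and> x \<in> T \<and> T \<subseteq> {x \<in> topspace (mtop P). regular_point P D x}"
    using U by blast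
qed

text \<open>Ranks are bounded by the dimension of the Euclidean space of the charts, so a maximum
  over \<open>U\<close> is attained; at such a point lower semicontinuity makes the rank locally
  constant.\<close>

lemma regular_points_dense:
  fixes P :: "('a, 'e::euclidean_space) manifold"
  assumes P: "smooth_manifold P" and D: "smooth_distribution P D" and int: "integrable_distribution P D"
    and U: "openin (mtop P) U" "U \<noteq> {}"
  shows "\<exists>x\<in>U. regular_point P D x"
proof -
  define rk where "rk x = leaf_dim P D (leaf_proj P D x)" for x
  have UP: "U \<subseteq> topspace (mtop P)" by (rule openin_subset[OF U(1)])
  have rk: "rk x = dim ((\<lambda>X. X d) ` D x)" if "x \<in> topspace (mtop P)" "d \<in> charts_at P x" for x d
    unfolding rk_def using leaf_dim_eq[OF P leaf_proj_leaf[OF int that(1)] that(2)] .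
  have bound: "rk x < Suc DIM('e)" if "x \<in> U" for x
  proof -
    have x: "x \<in> topspace (mtop P)" using that UP by blast
    obtain d where "d \<in> charts_at P x" using charts_at_nonempty[OF P x] by blast
    then show ?thesis using rk[OF x] by (simp add: dim_subset_UNIV less_Suc_eq_le)
  qed
  obtain x0 where "x0 \<in> U" using U(2) by blast
  then obtain x where x: "x \<in> U" and max: "\<And>y. y \<in> U \<Longrightarrow> rk y \<le> rk x"
    using ex_has_greatest_nat[of "\<lambda>x. x \<in> U" x0 rk "Suc DIM('e)"] bound by auto
  have xP: "x \<in> topspace (mtop P)" using x UP by blast
  obtain d where d: "d \<in> charts_at P x" using charts_at_nonempty[OF P xP] by blast
  then have dP: "d \<in> atlas P" by (simp add: charts_at_def)
  obtain N where N: "connected_integral_manifold P D N" and topN: "topspace (mtop N) = leaf_proj P D x"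
    using leaf_manifold[OF leaf_proj_leaf(1)[OF int xP]] .
  have xN: "x \<in> topspace (mtop N)" using topN leaf_proj_leaf(2)[OF int xP] by simp
  obtain F B \<phi> W A a where "leaf_parametrisation P D N x d F B \<phi> W A a"
    by (rule leaf_parametrisation_exists[OF P N xN d])
  then interpret lp: leaf_parametrisation P D N x d F B \<phi> W A a .
  obtain V where V: "openin (mtop P) V" "x \<in> V" "V \<subseteq> fst d"
    and rank: "\<And>y. y \<in> V \<Longrightarrow> dim ((\<lambda>X. X d) ` D x) \<le> dim ((\<lambda>X. X d) ` D y)"
    using lp.rank_lower_semicontinuous[OF D] by metis
  have "leaf_dim P D L = rk x" if L: "L \<in> leaves P D" "L \<inter> (U \<inter> V) \<noteq> {}" for L
  proof -
    obtain y where y: "y \<in> L" "y \<in> U" "y \<in> V" using L by blast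
    then have "d \<in> charts_at P y" using V(3) dP by (auto simp: charts_at_def)
    then have "rk x \<le> rk y" using rank[OF y(3)] rk[OF xP d] rk[of y d] y(2) UP by auto
    then have "rk y = rk x" using max[OF y(2)] by simp
    then show ?thesis using leaf_projI[OF int L(1) y(1)] by (simp add: rk_def)
  qed
  moreover have "openin (mtop P) (U \<inter> V)" "x \<in> U \<inter> V" using U V x by (auto simp: openin_Int)
  ultimately show ?thesis using x unfolding regular_point_def by blast
qed

lemma norm_increment_le_derivative_bound:
  fixes \<gamma> :: "real \<Rightarrow> 'a::euclidean_space"
  assumes d: "\<And>t. t \<in> {0..1} \<Longrightarrow> (\<gamma> has_vector_derivative v t) (at t within {0..1})"
    and b: "\<And>t. t \<in> {0..1} \<Longrightarrow> norm (v t) \<le> b" and t: "t \<in> {0..1}"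
  shows "norm (\<gamma> t - \<gamma> 0) \<le> b"
proof -
  have b0: "0 \<le> b" using b[OF t] norm_ge_zero order_trans by blast
  have "norm (\<gamma> t - \<gamma> 0) \<le> b * norm (t - 0)"
  proof (rule differentiable_bound[of "{0..1}" \<gamma> "\<lambda>s h. h *\<^sub>R v s"])
    show "onorm (\<lambda>h. h *\<^sub>R v s) \<le> b" if "s \<in> {0..1}" for s
      by (rule onorm_bound[OF b0]) (use mult_right_mono[OF b[OF that] abs_ge_zero] in \<open>simp add: mult.commute\<close>)
  qed (use d t in \<open>auto simp: has_vector_derivative_def\<close>)
  also have "\<dots> \<le> b * 1" using t b0 by (intro mult_left_mono) auto
  finally show ?thesis by simp
qed

text \<open>A leaf point \<open>y\<close> near the base point \<open>p\<close> is reached from \<open>p\<close> by the flow of a section of \<open>D\<close>.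
  By Gronwall's inequality the same flow carries a whole neighbourhood of \<open>p\<close> into a given
  neighbourhood of \<open>y\<close>, and it moves points within their leaves.\<close>

lemma (in leaf_parametrisation) regular_point_propagates:
  assumes D: "smooth_distribution P D" and int: "integrable_distribution P D"
  obtains Q where "openin (mtop N) Q" "p \<in> Q" "\<forall>y\<in>Q. regular_point P D y \<longrightarrow> regular_point P D p"
proof (rule lipschitz_lift[OF D])
  let ?E = "model P"
  define x0 where "x0 = snd d p"
  define s0 where "s0 = B x0"
  note s0 = base[folded x0_def, folded s0_def]
  fix Y :: "'e \<Rightarrow> 'e \<Rightarrow> 'e" and r K :: real
  assume r: "0 < r" and K: "0 \<le> K"
    and img: "\<And>w. w \<in> ball (snd d p) r \<inter> ?E \<Longrightarrow> w \<in> snd d ` fst d"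
    and YD: "\<And>w e. w \<in> ball (snd d p) r \<inter> ?E \<Longrightarrow> e \<in> F \<Longrightarrow> Y w e \<in> (\<lambda>X. X d) ` D (chart_inv d w)"
    and BY: "\<And>w e. w \<in> ball (snd d p) r \<inter> ?E \<Longrightarrow> e \<in> F \<Longrightarrow> B (Y w e) = e"
    and Yb: "\<And>w e. w \<in> ball (snd d p) r \<inter> ?E \<Longrightarrow> norm (Y w e) \<le> K * norm e"
    and Ylip: "\<And>w w' e. w \<in> ball (snd d p) r \<inter> ?E \<Longrightarrow> w' \<in> ball (snd d p) r \<inter> ?E \<Longrightarrow>
       norm (Y w e - Y w' e) \<le> K * norm (w - w') * norm e"
  note img = img[folded x0_def] and YD = YD[folded x0_def] and BY = BY[folded x0_def]
    and Yb = Yb[folded x0_def] and Ylip = Ylip[folded x0_def]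
  have E: "subspace ?E" by (rule smooth_manifold_subspace[OF P])
  have x0E: "x0 \<in> ?E" unfolding x0_def by (rule chart_in_model[OF P d_atlas p_in_d])
  have fd: "fst d \<subseteq> topspace (mtop P)" by (rule openin_subset[OF chart_homeomorphic(1)[OF P d_atlas]])
  have YE: "Y w e \<in> ?E" if w: "w \<in> ball x0 r \<inter> ?E" and e: "e \<in> F" for w e
  proof -
    obtain x where x: "x \<in> fst d" "w = snd d x" using img[OF w] by blast
    obtain X where X: "X \<in> D x" "Y w e = X d"
      using YD[OF w e] x chart_inv_chart[OF P d_atlas x(1)] by auto
    have "D x \<subseteq> tangent_space P x" using D x fd unfolding smooth_distribution_def by blast
    then have "X \<in> tangent_space P x" using X by blast
    moreover have "d \<in> charts_at P x" using x d_atlas by (simp add: charts_at_def)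
    ultimately show ?thesis using X tangent_spaceD(1) by metis
  qed
  have \<phi>E: "\<phi> s \<in> ?E" if "s \<in> W \<inter> F" for s
    using \<phi>_in_leaf[OF that] chart_\<phi>[OF that] chart_in_model[OF P d_atlas] by (metis IntD2)
  have "open (W \<inter> \<phi> -` ball x0 r)" by (rule continuous_open_preimage[OF continuous_on_\<phi> W open_ball])
  moreover have "s0 \<in> W \<inter> \<phi> -` ball x0 r" using s0 \<phi>_base r by (simp add: s0_def x0_def)
  ultimately obtain \<epsilon>0 where \<epsilon>0: "0 < \<epsilon>0" "ball s0 \<epsilon>0 \<subseteq> W \<inter> \<phi> -` ball x0 r" by (rule openE)
  \<comment> \<open>\<open>m\<close> will bound \<open>K * norm e\<close>, which is both the
    Lipschitz constant and the speed of the field for \<open>e\<close>. The 1/2 serves the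
    contraction; a displacement of at most \<open>r/4\<close>, from a start within
    \<open>r/4\<close> of \<open>x0\<close>, stays in the ball of radius \<open>r/2\<close>. The
    choice of \<open>\<epsilon>\<close> enforces the bound, with 1 added to avoid dividing by
    zero.\<close>
  define m where "m = min (1/2) (r/4)"
  define \<epsilon> where "\<epsilon> = min \<epsilon>0 (m / (K + 1))"
  have m: "0 < m" "m \<le> 1/2" "m \<le> r/4" using r by (auto simp: m_def)
  have \<epsilon>: "0 < \<epsilon>" using \<epsilon>0 m K by (simp add: \<epsilon>_def)
  have \<epsilon>W: "s \<in> W" "\<phi> s \<in> ball x0 r" if "s \<in> ball s0 \<epsilon>" for s
  proof -
    have "s \<in> ball s0 \<epsilon>0" using that by (simp add: \<epsilon>_def)
    then show "s \<in> W" "\<phi> s \<in> ball x0 r" using \<epsilon>0(2) by auto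
  qed
  show thesis
  proof (rule that)
    show "openin (mtop N) ((\<lambda>s. chart_inv d (\<phi> s)) ` (ball s0 \<epsilon> \<inter> F))"
      by (rule \<phi>_open[OF open_ball]) (use \<epsilon>W in blast)
    have "p = chart_inv d (\<phi> s0)" using chart_inv_\<phi>_base by (simp add: s0_def x0_def)
    then show "p \<in> (\<lambda>s. chart_inv d (\<phi> s)) ` (ball s0 \<epsilon> \<inter> F)" using \<epsilon> s0 by auto
  next
    show "\<forall>y\<in>(\<lambda>s. chart_inv d (\<phi> s)) ` (ball s0 \<epsilon> \<inter> F). regular_point P D y \<longrightarrow> regular_point P D p"
    proof (intro ballI impI)
      fix y assume "y \<in> (\<lambda>s. chart_inv d (\<phi> s)) ` (ball s0 \<epsilon> \<inter> F)" and reg: "regular_point P D y"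
      then obtain s where s: "s \<in> ball s0 \<epsilon>" "s \<in> F" and y: "y = chart_inv d (\<phi> s)" by auto
      have sWF: "s \<in> W \<inter> F" using s \<epsilon>W by blast
      obtain U k where U: "openin (mtop P) U" "y \<in> U" "\<forall>L\<in>leaves P D. L \<inter> U \<noteq> {} \<longrightarrow> leaf_dim P D L = k"
        using reg unfolding regular_point_def by blast
      \<comment> \<open>With this \<open>e\<close> the segment from \<open>s0\<close> to
        \<open>s\<close> takes unit time, so the lifted flow leads from \<open>p\<close> to
        \<open>y\<close> in unit time.\<close>
      define e where "e = s - s0"
      have e: "e \<in> F" unfolding e_def using s s0 F subspace_diff by blast
      have "norm e < \<epsilon>" using s(1) by (simp add: e_def dist_norm norm_minus_commute)
      also have "\<epsilon> \<le> m / (K + 1)" by (simp add: \<epsilon>_def)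
      finally have "K * norm e \<le> (K + 1) * (m / (K + 1))" using K by (intro mult_mono) auto
      then have Ke: "K * norm e \<le> m" using K by simp
      define \<eta> where "\<eta> t = \<phi> (s0 + t *\<^sub>R e)" for t
      have line: "s0 + t *\<^sub>R e \<in> ball s0 \<epsilon> \<inter> F" if "t \<in> {0..1}" for t
      proof
        have "norm (t *\<^sub>R e) \<le> 1 * norm e" using that unfolding norm_scaleR by (intro mult_right_mono) auto
        also have "\<dots> < \<epsilon>" using s by (simp add: e_def dist_norm norm_minus_commute)
        finally show "s0 + t *\<^sub>R e \<in> ball s0 \<epsilon>" by (simp add: dist_norm)
        show "s0 + t *\<^sub>R e \<in> F" using F e s0 by (simp add: subspace_add subspace_scale)
      qed
      have \<eta>E: "\<eta> t \<in> ball x0 r \<inter> ?E" if "t \<in> {0..1}" for t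
        using line[OF that] \<epsilon>W \<phi>E unfolding \<eta>_def by blast
      have \<eta>': "(\<eta> has_vector_derivative Y (\<eta> t) e) (at t within {0..1})" if t: "t \<in> {0..1}" for t
      proof -
        have lWF: "s0 + t *\<^sub>R e \<in> W \<inter> F" using line[OF t] \<epsilon>W by blast
        have "((\<lambda>t. s0 + t *\<^sub>R e) has_vector_derivative e) (at t within {0..1})"
          by (auto intro!: derivative_eq_intros)
        then have "(\<eta> has_vector_derivative A (s0 + t *\<^sub>R e) e) (at t within {0..1})"
          using vector_derivative_diff_chain_within[of "\<lambda>t. s0 + t *\<^sub>R e" e t "{0..1}" \<phi> "A (s0 + t *\<^sub>R e)"]
            \<phi>_deriv lWF by (auto simp: o_def \<eta>_def[abs_def] intro: has_derivative_at_withinI)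
        \<comment> \<open>At a leaf point only one vector of \<open>D\<close> lies over
          \<open>e\<close>, since \<open>A\<close> after \<open>B\<close> fixes \<open>D\<close>
          there.\<close>
        moreover have "A (s0 + t *\<^sub>R e) e = Y (\<eta> t) e"
          using YD[OF \<eta>E[OF t] e] BY[OF \<eta>E[OF t] e] A_B[OF lWF] by (auto simp: \<eta>_def)
        ultimately show ?thesis by simp
      qed
      have "openin (top_of_set ?E) (snd d ` (U \<inter> fst d))"
        by (rule chart_image_open[OF P d_atlas]) (use U chart_homeomorphic(1)[OF P d_atlas] in \<open>auto simp: openin_Int\<close>)
      then obtain T where T: "open T" "snd d ` (U \<inter> fst d) = ?E \<inter> T" by (metis openin_open)
      have "\<phi> s \<in> snd d ` (U \<inter> fst d)"
        using U(2) \<phi>_in_leaf[OF sWF] chart_\<phi>[OF sWF] unfolding y by (metis IntD2 IntI image_eqI)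
      then have "\<phi> s \<in> T" using T by blast
      with T(1) obtain \<delta>1 where \<delta>1: "0 < \<delta>1" "ball (\<phi> s) \<delta>1 \<subseteq> T" by (rule openE)
      \<comment> \<open>Gronwall over unit time with rate 1/2 expands distances by at most
        \<open>exp (1/2)\<close>; the bound \<open>r/4\<close> is the room left by
        \<open>m\<close>.\<close>
      define \<delta> where "\<delta> = min (r/4) (\<delta>1 / exp (1/2))"
      have \<delta>: "0 < \<delta>" "\<delta> \<le> r/4" "exp (1/2) * \<delta> \<le> \<delta>1"
        using r \<delta>1 by (auto simp: \<delta>_def min_def field_simps)
      define U' where "U' = {x \<in> fst d. snd d x \<in> ball x0 \<delta>}"
      have ld: "leaf_dim P D L = k" if L: "L \<in> leaves P D" "L \<inter> U' \<noteq> {}" for L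
      proof -
        obtain x where x: "x \<in> L" "x \<in> fst d" "snd d x \<in> ball x0 \<delta>" using L by (auto simp: U'_def)
        define w where "w = snd d x"
        have wE: "w \<in> ?E" unfolding w_def by (rule chart_in_model[OF P d_atlas x(2)])
        have wd: "norm (w - x0) < \<delta>" using x(3) by (simp add: w_def dist_norm norm_minus_commute)
        define S where "S = cball x0 (r/2) \<inter> ?E"
        have S: "closed S" "convex S"
          unfolding S_def
          by (rule closed_Int[OF closed_cball closed_subspace[OF E]],
              rule convex_Int[OF convex_cball subspace_imp_convex[OF E]])
        have "x0 \<in> S" unfolding S_def using x0E r by simp
        then have S_ne: "S \<noteq> {}" by blast
        have Sr: "v \<in> ball x0 r \<inter> ?E" if "v \<in> S" for v using that r by (auto simp: S_def)
        \<comment> \<open>The nearest-point map onto the convex set \<open>S\<close> does not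
          increase distances, so composing with it extends the field to the whole space with the
          same Lipschitz constant. The solution never leaves \<open>S\<close>, so the extension has
          no effect on it.\<close>
        define G where "G v = Y (closest_point S v) e" for v
        have cpS: "closest_point S v \<in> S" for v by (rule closest_point_in_set[OF S(1) S_ne])
        have Glip: "norm (G v - G v') \<le> norm (v - v') / 2" for v v'
        proof -
          have "norm (G v - G v') \<le> K * norm (closest_point S v - closest_point S v') * norm e"
            unfolding G_def by (intro Ylip Sr cpS)
          also have "\<dots> = (K * norm e) * dist (closest_point S v) (closest_point S v')" by (simp add: dist_norm mult_ac)
          also have "\<dots> \<le> 1/2 * dist v v'"
            using closest_point_lipschitz[OF S(2,1) S_ne, of v v'] Ke m K by (intro mult_mono) auto
          finally show ?thesis by (simp add: dist_norm)
        qed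
        obtain \<gamma> where \<gamma>0: "\<gamma> 0 = w"
          and \<gamma>G: "\<And>t. t \<in> {0..1} \<Longrightarrow> (\<gamma> has_vector_derivative G (\<gamma> t)) (at t within {0..1})"
          using picard_unit_interval[OF Glip] by metis
        obtain \<rho> where \<rho>: "linear \<rho>" "range \<rho> \<subseteq> ?E" "\<And>x. x \<in> ?E \<Longrightarrow> \<rho> x = x"
          using subspace_projection[OF E] by metis
        have \<gamma>S: "\<gamma> t \<in> S" if t: "t \<in> {0..1}" for t
        proof -
          \<comment> \<open>The field takes values in the model subspace, so the component of the
            curve off that subspace is constant.\<close>
          have "\<gamma> t - \<rho> (\<gamma> t) = 0"
          proof (rule vanishing_of_linear_growth[of 0 1 "\<lambda>t. \<gamma> t - \<rho> (\<gamma> t)" "\<lambda>_. 0" 0 0 t])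
            fix t :: real assume t: "t \<in> {0..1}"
            have "((\<lambda>t. \<rho> (\<gamma> t)) has_vector_derivative \<rho> (G (\<gamma> t))) (at t within {0..1})"
              using bounded_linear.has_vector_derivative[OF _ \<gamma>G[OF t]] \<rho>(1) by (simp add: linear_conv_bounded_linear)
            moreover have "\<rho> (G (\<gamma> t)) = G (\<gamma> t)" unfolding G_def by (intro \<rho>(3) YE Sr cpS e)
            ultimately show "((\<lambda>t. \<gamma> t - \<rho> (\<gamma> t)) has_vector_derivative 0) (at t within {0..1})"
              using has_vector_derivative_diff[OF \<gamma>G[OF t]] by fastforce
          qed (use t wE \<rho>(3) \<gamma>0 in auto)
          then have "\<gamma> t \<in> ?E" using \<rho>(2) by (metis eq_iff_diff_eq_0 rangeI subsetD)
          moreover have "norm (\<gamma> t - \<gamma> 0) \<le> m"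
          proof (rule norm_increment_le_derivative_bound[OF \<gamma>G _ t])
            fix t
            show "norm (G (\<gamma> t)) \<le> m"
              unfolding G_def by (rule order_trans[OF Yb[OF Sr[OF cpS]] Ke])
          qed
          then have "norm (\<gamma> t - x0) \<le> r/2"
            using norm_triangle_ineq[of "\<gamma> t - w" "w - x0"] wd \<delta>(2) m(3) \<gamma>0 by simp
          ultimately show ?thesis by (simp add: S_def dist_norm norm_minus_commute)
        qed
        have \<gamma>': "(\<gamma> has_vector_derivative Y (\<gamma> t) e) (at t within {0..1})" if "t \<in> {0..1}" for t
          using \<gamma>G[OF that] closest_point_self[OF \<gamma>S[OF that]] by (simp add: G_def)
        have "leaf_proj P D (chart_inv d (\<gamma> 0)) = leaf_proj P D (chart_inv d (\<gamma> 1))"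
        proof (rule integral_curve_in_leaf[OF P int d_atlas, where Z = "\<lambda>w. Y w e" and K = "K * norm e"])
          show "norm (Y w e - Y w' e) \<le> K * norm e * norm (w - w')"
            if "w \<in> ball x0 r \<inter> ?E" "w' \<in> ball x0 r \<inter> ?E" for w w'
            using Ylip[OF that, of e] by (simp add: mult_ac)
        qed (use img YD e Sr \<gamma>S \<gamma>' in auto)
        moreover have "chart_inv d (\<gamma> 0) = x" using \<gamma>0 chart_inv_chart[OF P d_atlas x(2)] by (simp add: w_def)
        ultimately have lp1: "leaf_proj P D (chart_inv d (\<gamma> 1)) = L" using leaf_projI[OF int L(1) x(1)] by simp
        have "norm (\<gamma> 1 - \<eta> 1) \<le> exp ((1/2) * (1 - 0)) * norm (\<gamma> 0 - \<eta> 0)"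
        proof (rule gronwall_norm[of 0 1 "\<lambda>t. \<gamma> t - \<eta> t" "\<lambda>t. Y (\<gamma> t) e - Y (\<eta> t) e"])
          fix t :: real assume t: "t \<in> {0..1}"
          show "((\<lambda>t. \<gamma> t - \<eta> t) has_vector_derivative Y (\<gamma> t) e - Y (\<eta> t) e) (at t within {0..1})"
            by (intro has_vector_derivative_diff \<gamma>' \<eta>' t)
          have "norm (Y (\<gamma> t) e - Y (\<eta> t) e) \<le> (K * norm e) * norm (\<gamma> t - \<eta> t)"
            using Ylip[OF Sr[OF \<gamma>S[OF t]] \<eta>E[OF t], of e] by (simp add: mult_ac)
          also have "\<dots> \<le> 1/2 * norm (\<gamma> t - \<eta> t)" using Ke m by (intro mult_right_mono) auto
          finally show "norm (Y (\<gamma> t) e - Y (\<eta> t) e) \<le> 1/2 * norm (\<gamma> t - \<eta> t)" .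
        qed simp
        also have "\<eta> 0 = x0" using \<phi>_base by (simp add: \<eta>_def s0_def x0_def)
        also have "\<eta> 1 = \<phi> s" by (simp add: \<eta>_def e_def)
        also have "exp ((1/2) * (1 - 0)) * norm (\<gamma> 0 - x0) < exp (1/2) * \<delta>" using wd \<gamma>0 by simp
        finally have "\<gamma> 1 \<in> ball (\<phi> s) \<delta>1" using \<delta>(3) by (simp add: dist_norm norm_minus_commute)
        then have "\<gamma> 1 \<in> snd d ` (U \<inter> fst d)" using T(2) \<delta>1(2) \<gamma>S[of 1] by (auto simp: S_def)
        then have "chart_inv d (\<gamma> 1) \<in> U" "chart_inv d (\<gamma> 1) \<in> topspace (mtop P)"
          using chart_inv_chart[OF P d_atlas] fd by auto
        \<comment> \<open>The flow starts in \<open>L\<close>, stays in it and ends in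
          \<open>U\<close>, where the dimension of the leaves is known.\<close>
        then have "L \<inter> U \<noteq> {}" using leaf_proj_leaf(2)[OF int, of "chart_inv d (\<gamma> 1)"] lp1 by auto
        then show ?thesis using U(3) L(1) by blast
      qed
      show "regular_point P D p"
        unfolding regular_point_def
      proof (rule exI[of _ U'], rule exI[of _ k], intro conjI ballI impI)
        show "openin (mtop P) U'" unfolding U'_def by (rule chart_preimage_open[OF P d_atlas open_ball])
        show "p \<in> U'" using p_in_d \<delta>(1) by (simp add: U'_def x0_def)
      qed (rule ld)
    qed
  qed
qed

text \<open>The regular points are open in the leaf because its inclusion is continuous. The
  irregular ones are open too: by the contrapositive of \<open>regular_point_propagates\<close>, an
  irregular \<open>p\<close> has a neighbourhood in the leaf without regular points. Connectedness
  of the leaf decides.\<close>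

lemma leaf_of_regular_point:
  fixes P :: "('a, 'e::euclidean_space) manifold"
  assumes P: "smooth_manifold P" and D: "smooth_distribution P D" and int: "integrable_distribution P D"
    and z: "z \<in> topspace (mtop P)" "regular_point P D z"
  shows "leaf_proj P D z \<in> regular_leaves P D"
proof -
  define L where "L = leaf_proj P D z"
  have L: "L \<in> leaves P D" "z \<in> L" using leaf_proj_leaf[OF int z(1)] by (auto simp: L_def)
  obtain N where N: "connected_integral_manifold P D N" and topN: "topspace (mtop N) = L"
    using leaf_manifold[OF L(1)] .
  have con: "connected_space (mtop N)" and cont: "continuous_map (mtop N) (mtop P) (\<lambda>x. x)"
    using N by (auto simp: connected_integral_manifold_def immersed_submanifold_def immersion_def smooth_map_def)
  define R where "R = {x \<in> topspace (mtop N). regular_point P D x}"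
  have "R = {x \<in> topspace (mtop N). x \<in> {x \<in> topspace (mtop P). regular_point P D x}}"
    using leaf_subset[OF int L(1)] topN by (auto simp: R_def)
  then have opR: "openin (mtop N) R"
    using openin_continuous_map_preimage[OF cont openin_regular_points] by simp
  have "openin (mtop N) (topspace (mtop N) - R)"
  proof (subst openin_subopen, intro ballI)
    fix p assume p: "p \<in> topspace (mtop N) - R"
    then have pP: "p \<in> topspace (mtop P)" using leaf_subset[OF int L(1)] topN by auto
    obtain d where d: "d \<in> charts_at P p" using charts_at_nonempty[OF P pP] by blast
    obtain F B \<phi> W A a where "leaf_parametrisation P D N p d F B \<phi> W A a"
      by (rule leaf_parametrisation_exists[OF P N _ d]) (use p in blast)
    then interpret lp: leaf_parametrisation P D N p d F B \<phi> W A a .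
    obtain Q where "openin (mtop N) Q" "p \<in> Q" "\<forall>y\<in>Q. regular_point P D y \<longrightarrow> regular_point P D p"
      by (rule lp.regular_point_propagates[OF D int])
    moreover from this have "Q \<subseteq> topspace (mtop N) - R"
      using p openin_subset unfolding R_def by blast
    ultimately show "\<exists>T. openin (mtop N) T \<and> p \<in> T \<and> T \<subseteq> topspace (mtop N) - R" by blast
  qed
  then have "closedin (mtop N) R" using opR openin_subset by (auto simp: closedin_def)
  then have "R = {} \<or> R = topspace (mtop N)" using con opR by (auto simp: connected_space_clopen_in)
  moreover have "z \<in> R" using L z topN by (simp add: R_def)
  ultimately have "\<forall>x\<in>L. regular_point P D x" using topN by (auto simp: R_def)
  then show ?thesis using L by (simp add: regular_leaves_def L_def)
qed

section \<open>Separation of points in the leaf space\<close>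

theorem theorem4p10:
  fixes P :: "('a, 'e::euclidean_space) manifold"
    and D :: "'a \<Rightarrow> ('a, 'e) tangent set"
    and I :: "'i set"
    and C :: "'i \<Rightarrow> 'a \<Rightarrow> real"
  assumes "smooth_manifold P"
    and "second_countable (mtop P)"
    and "smooth_distribution P D"
    and "integrable_distribution P D"
    and "\<And>i. i \<in> I \<Longrightarrow> continuous_first_integral P D (C i)"
    and "separates_regular_leaves P D I C"
    and "open_map (mtop P)
           (subtopology (powertop_real I) ((\<lambda>z. \<lambda>i\<in>I. C i z) ` topspace (mtop P)))
           (\<lambda>z. \<lambda>i\<in>I. C i z)"
    and "z \<in> topspace (mtop P)"
  shows "T2_bar P D z = topspace (mtop P) \<inter> (\<Inter>i\<in>I. {x \<in> topspace (mtop P). C i x = C i z})"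
proof -
  note P = assms(1) and D = assms(3) and int = assms(4) and opC = assms(7) and z = assms(8)
  let ?X = "topspace (mtop P)"
  let ?f = "\<lambda>z. \<lambda>i\<in>I. C i z"
  let ?Y = "subtopology (powertop_real I) (?f ` ?X)"
  let ?R = "{x \<in> ?X. regular_point P D x}"
  have contC: "continuous_map (mtop P) euclideanreal (C i)" if "i \<in> I" for i
    using assms(5)[OF that] by (simp add: continuous_first_integral_def)
  have Cleaf: "C i x = C i y" if "i \<in> I" "x \<in> ?X" "y \<in> ?X" "leaf_proj P D x = leaf_proj P D y" for i x y
    using assms(5)[OF that(1)] leaf_proj_leaf[OF int that(2)] leaf_proj_leaf[OF int that(3)] that(4)
    unfolding continuous_first_integral_def by metis
  have contf: "continuous_map (mtop P) ?Y ?f"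
    using contC by (auto simp: continuous_map_in_subtopology continuous_map_componentwise)
  have feq: "C i x = C i y" if "?f x = ?f y" "i \<in> I" for x y i
    using fun_cong[OF that(1), of i] that(2) by simp
  have opsp: "openin (leaf_space P D) U \<longleftrightarrow> U \<subseteq> leaf_proj P D ` ?X \<and> openin (mtop P) {x \<in> ?X. leaf_proj P D x \<in> U}" for U
    by (simp add: leaf_space_def openin_quotient_topology)
  have topsp: "topspace (leaf_space P D) = leaf_proj P D ` ?X"
    by (simp add: leaf_space_def topspace_quotient_topology)
  have dense: "\<exists>x\<in>U. x \<in> ?R" if "openin (mtop P) U" "U \<noteq> {}" for U
    using regular_points_dense[OF P D int that] openin_subset[OF that(1)] by blast
  have sep: "leaf_proj P D u = leaf_proj P D v" if "u \<in> ?R" "v \<in> ?R" "?f u = ?f v" for u v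
  proof (rule ccontr)
    assume ne: "leaf_proj P D u \<noteq> leaf_proj P D v"
    have uv: "u \<in> ?X" "v \<in> ?X" using that by auto
    have "leaf_proj P D u \<in> regular_leaves P D" "leaf_proj P D v \<in> regular_leaves P D"
      using leaf_of_regular_point[OF P D int] that by auto
    then obtain i where "i \<in> I" "\<forall>x\<in>leaf_proj P D u. \<forall>y\<in>leaf_proj P D v. C i x \<noteq> C i y"
      using assms(6) ne unfolding separates_regular_leaves_def by blast
    then show False using leaf_proj_leaf(2)[OF int] uv feq[OF that(3)] by blast
  qed
  have "x \<in> T2_bar P D z \<longleftrightarrow> (\<forall>i\<in>I. C i x = C i z)" if x: "x \<in> ?X" for x
  proof
    assume "x \<in> T2_bar P D z"
    then have T2: "\<And>U V. openin (leaf_space P D) U \<Longrightarrow> openin (leaf_space P D) V \<Longrightarrow>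
        leaf_proj P D z \<in> U \<Longrightarrow> leaf_proj P D x \<in> V \<Longrightarrow> U \<inter> V \<noteq> {}"
      by (auto simp: T2_bar_def T2_set_def)
    show "\<forall>i\<in>I. C i x = C i z"
    proof (intro ballI, rule ccontr)
      fix i assume i: "i \<in> I" and "C i x \<noteq> C i z"
      then obtain G H where GH: "open G" "open H" "C i z \<in> G" "C i x \<in> H" "G \<inter> H = {}"
        using hausdorff[of "C i z" "C i x"] by metis
      \<comment> \<open>A set cut out by the value of a first integral is saturated, so its image is
        open in the quotient; disjoint neighbourhoods of two real values thus separate the
        leaves.\<close>
      define sat where "sat G = leaf_proj P D ` {y \<in> ?X. C i y \<in> G}" for G
      have pre: "{y \<in> ?X. leaf_proj P D y \<in> sat G} = {y \<in> ?X. C i y \<in> G}" for G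
      proof (intro equalityI subsetI)
        fix y assume "y \<in> {y \<in> ?X. leaf_proj P D y \<in> sat G}"
        then obtain y' where y: "y \<in> ?X" "y' \<in> ?X" "C i y' \<in> G" "leaf_proj P D y = leaf_proj P D y'"
          unfolding sat_def by blast
        then show "y \<in> {y \<in> ?X. C i y \<in> G}" using Cleaf[OF i y(1,2,4)] by simp
      qed (auto simp: sat_def)
      have "openin (leaf_space P D) (sat G)" if "open G" for G
        unfolding opsp pre
        using openin_continuous_map_preimage[OF contC[OF i], of G] that by (auto simp: sat_def)
      then have "sat G \<inter> sat H \<noteq> {}"
        using GH x z by (intro T2) (auto simp: sat_def)
      then obtain y y' where "y \<in> ?X" "y' \<in> ?X" "C i y \<in> G" "C i y' \<in> H" "leaf_proj P D y = leaf_proj P D y'"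
        unfolding sat_def by blast
      then show False using Cleaf[OF i, of y y'] GH by auto
    qed
  next
    assume eq: "\<forall>i\<in>I. C i x = C i z"
    then have fxz: "?f x = ?f z" by (auto intro: restrict_ext)
    have "U \<inter> V \<noteq> {}" if U: "openin (leaf_space P D) U" "leaf_proj P D z \<in> U"
      and V: "openin (leaf_space P D) V" "leaf_proj P D x \<in> V" for U V
    proof -
      define U' where "U' = {y \<in> ?X. leaf_proj P D y \<in> U}"
      define V' where "V' = {y \<in> ?X. leaf_proj P D y \<in> V}"
      have opU: "openin (mtop P) U'" and opV: "openin (mtop P) V'"
        using U V by (auto simp: opsp U'_def V'_def)
      have img: "openin ?Y (?f ` S)" if "openin (mtop P) S" for S
        using opC that unfolding open_map_def by blast
      have pre: "openin (mtop P) {y \<in> ?X. ?f y \<in> S}" if "openin ?Y S" for S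
        by (rule openin_continuous_map_preimage[OF contf that])
      \<comment> \<open>\<open>?f\<close> is open, so the image of \<open>V'\<close> is open; it
        contains the common image of \<open>x\<close> and \<open>z\<close>, so its preimage is a
        neighbourhood of \<open>z\<close>.\<close>
      have "openin (mtop P) (U' \<inter> {y \<in> ?X. ?f y \<in> ?f ` V'})"
        by (intro openin_Int opU pre img opV)
      moreover have "z \<in> U' \<inter> {y \<in> ?X. ?f y \<in> ?f ` V'}"
        using U V z x fxz by (auto simp: U'_def V'_def intro: rev_image_eqI)
      ultimately obtain u where u: "u \<in> U'" "?f u \<in> ?f ` V'" "u \<in> ?R" using dense by blast
      then obtain v where v: "v \<in> V'" "?f u = ?f v" by blast
      \<comment> \<open>\<open>v\<close> need not be regular. The image of the open set
        \<open>U' \<inter> ?R\<close> is open and contains the image of \<open>v\<close>, so density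
        near \<open>v\<close> yields a regular point of \<open>V'\<close> whose partner in
        \<open>U'\<close> is regular as well.\<close>
      have "openin (mtop P) (V' \<inter> {y \<in> ?X. ?f y \<in> ?f ` (U' \<inter> ?R)})"
        by (intro openin_Int opV pre img opU openin_regular_points)
      moreover have "v \<in> V' \<inter> {y \<in> ?X. ?f y \<in> ?f ` (U' \<inter> ?R)}"
      proof -
        have "?f v \<in> ?f ` (U' \<inter> ?R)" unfolding v(2)[symmetric] using u by blast
        then show ?thesis using v(1) by (simp add: V'_def)
      qed
      ultimately obtain v' where v': "v' \<in> V'" "?f v' \<in> ?f ` (U' \<inter> ?R)" "v' \<in> ?R" using dense by blast
      then obtain u' where u': "u' \<in> U'" "u' \<in> ?R" "?f v' = ?f u'" by blast
      then have "leaf_proj P D v' = leaf_proj P D u'" using sep v'(3) by blast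
      then show ?thesis using u' v' by (auto simp: U'_def V'_def)
    qed
    then show "x \<in> T2_bar P D z"
      using x by (auto simp: T2_bar_def T2_set_def topsp)
  qed
  moreover have "T2_bar P D z \<subseteq> ?X" by (auto simp: T2_bar_def)
  ultimately show ?thesis by blast
qed

end
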